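(* Let $\mathbf{s}^{(i)}\in\mathbb{R}^{TD}$ be the current iterate and let $\lambda_{i+1}\ge 0$ be fixed. Solving for the Levenberg–Marquardt update, that is, the $\Delta\mathbf{s}\in\mathbb{R}^{TD}$ that minimizes $$\widehat{\mathcal{L}}_{\mathbf{s}^{(i)}}(\Delta\mathbf{s})=\frac12\left\|\mathbf{r}(\mathbf{s}^{(i)})+\mathbf{J}(\mathbf{s}^{(i)})\Delta\mathbf{s}\right\|_2^2+\frac{\lambda_{i+1}}{2}\|\Delta\mathbf{s}\|_2^2,$$ is equivalent to finding the maximum a posteriori (MAP) estimate of $\mathbf{s}_{1:T}$ in a linear Gaussian state space model, which can be done in $\mathcal{O}(\log T)$ time on a sufficiently large parallel machine.
   Context: A nonlinear state space model with state $s_t\in\mathbb{R}^D$ evolves as $s_t=f_t(s_{t-1})$, $t=1,\dots,T$, from a fixed known initial condition $s_0$, with differentiable transition functions $f_t:\mathbb{R}^D\to\mathbb{R}^D$. A trajectory is written $\mathbf{s}=\mathbf{s}_{1:T}=(s_1,\dots,s_T)\in\mathbb{R}^{TD}$. The residual $\mathbf{r}:\mathbb{R}^{TD}\to\mathbb{R}^{TD}$ has blocks $r_t(\mathbf{s})=s_t-f_t(s_{t-1})\in\mathbb{R}^D$ for $t=1,\dots,T$, and $\mathbf{J}(\mathbf{s})=\frac{\partial\mathbf{r}}{\partial\mathbf{s}}(\mathbf{s})\in\mathbb{R}^{TD\times TD}$ is its Jacobian. The function $\widehat{\mathcal{L}}_{\mathbf{s}^{(i)}}$ is the Lagrangian of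 the trust-region problem of minimizing $\frac12\|\mathbf{r}(\mathbf{s}^{(i)})+\mathbf{J}(\mathbf{s}^{(i)})\Delta\mathbf{s}\|_2^2$ subject to a bound on $\|\Delta\mathbf{s}\|_2$; the update gives the next iterate $\mathbf{s}^{(i+1)}=\mathbf{s}^{(i)}+\Delta\mathbf{s}$. A linear Gaussian state space model is a probabilistic model in which latent variables $s_t$ follow linear dynamics with Gaussian noise (time-varying coefficients and offsets allowed) and emit observations through linear readouts with Gaussian noise; the case $\lambda_{i+1}=0$ corresponds to having no observations (equivalently, observations with infinite variance). The MAP estimate is the mode of the posterior distribution of the latent variables given the observations. *)

theory Defs
  imports "HOL-Analysis.Analysis" "HOL-Library.Landau_Symbols"
begin

section \<open>Trajectories and the Levenberg--Marquardt objective\<close>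

text \<open>
  The horizon T has to vary inside a statement (asymptotics in T), so a trajectory
  (s 1, ..., s T) is a function on nat that is undefined outside 1..T: the set
  below is the space of TD-dimensional real vectors, with D the cardinality of the type 'd.
  The fixed initial state is not part of the trajectory; \<open>s(0 := s0)\<close> prepends it.
\<close>

definition traj :: "nat \<Rightarrow> (nat \<Rightarrow> real^'d) set" where
  "traj T = (\<Pi>\<^sub>E t\<in>{1..T}. UNIV)"

definition traj_add :: "nat \<Rightarrow> (nat \<Rightarrow> real^'d) \<Rightarrow> (nat \<Rightarrow> real^'d) \<Rightarrow> nat \<Rightarrow> real^'d" where
  "traj_add T s \<Delta> = (\<lambda>t\<in>{1..T}. s t + \<Delta> t)"

definition residual :: "(nat \<Rightarrow> real^'d \<Rightarrow> real^'d) \<Rightarrow> real^'d \<Rightarrow> (nat \<Rightarrow> real^'d) \<Rightarrow> nat \<Rightarrow> real^'d" where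
  "residual f s0 s t = s t - f t ((s(0 := s0)) (t - 1))"

text \<open>The D by D block in block row t and block column u of the TD by TD Jacobian of the
  residual (rows and columns 1..T): the partial derivative of the t-th residual block with
  respect to the u-th state.\<close>

definition residual_jac ::
  "(nat \<Rightarrow> real^'d \<Rightarrow> real^'d) \<Rightarrow> real^'d \<Rightarrow> (nat \<Rightarrow> real^'d) \<Rightarrow> nat \<Rightarrow> nat \<Rightarrow> real^'d^'d" where
  "residual_jac f s0 s t u = jacobian (\<lambda>x. residual f s0 (s(u := x)) t) (at (s u))"

definition lm_objective ::
  "(nat \<Rightarrow> real^'d \<Rightarrow> real^'d) \<Rightarrow> real^'d \<Rightarrow> nat \<Rightarrow> real \<Rightarrow> (nat \<Rightarrow> real^'d) \<Rightarrow> (nat \<Rightarrow> real^'d) \<Rightarrow> real" where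
  "lm_objective f s0 T lam s \<Delta> =
     1/2 * (\<Sum>t=1..T. (norm (residual f s0 s t + (\<Sum>u=1..T. residual_jac f s0 s t u *v \<Delta> u)))\<^sup>2)
     + lam/2 * (\<Sum>t=1..T. (norm (\<Delta> t))\<^sup>2)"


section \<open>Linear Gaussian state space models\<close>

definition pos_def_matrix :: "real^'n^'n \<Rightarrow> bool" where
  "pos_def_matrix A \<longleftrightarrow> transpose A = A \<and> (\<forall>x. x \<noteq> 0 \<longrightarrow> x \<bullet> (A *v x) > 0)"

text \<open>Density of the multivariate normal distribution with mean m and covariance S.\<close>

definition mvn_density :: "real^'n \<Rightarrow> real^'n^'n \<Rightarrow> real^'n \<Rightarrow> real" where
  "mvn_density m S x =
     exp (- ((x - m) \<bullet> (matrix_inv S *v (x - m))) / 2) / sqrt ((2 * pi) ^ CARD('n) * det S)"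

text \<open>
  For t = 1, ..., T the state satisfies
  \<open>s t = trans t *v s (t - 1) + trans_offset t + noise\<close> with noise covariance \<open>trans_cov t\<close>,
  where \<open>s 0 = init_state\<close>, and for t in \<open>obs_times\<close> an observation
  \<open>y t = readout t *v s t + obs_offset t + noise\<close> is emitted, with noise covariance \<open>obs_cov t\<close>;
  all noises are independent, centred and Gaussian.
\<close>

record ('d::finite, 'm::finite) lgssm =
  init_state :: "real^'d"
  trans :: "nat \<Rightarrow> real^'d^'d"
  trans_offset :: "nat \<Rightarrow> real^'d"
  trans_cov :: "nat \<Rightarrow> real^'d^'d"
  obs_times :: "nat set"
  readout :: "nat \<Rightarrow> real^'d^'m"
  obs_offset :: "nat \<Rightarrow> real^'m"
  obs_cov :: "nat \<Rightarrow> real^'m^'m"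

definition valid_lgssm :: "nat \<Rightarrow> ('d::finite, 'm::finite) lgssm \<Rightarrow> bool" where
  "valid_lgssm T M \<longleftrightarrow>
     (\<forall>t\<in>{1..T}. pos_def_matrix (trans_cov M t)) \<and>
     obs_times M \<subseteq> {1..T} \<and>
     (\<forall>t\<in>obs_times M. pos_def_matrix (obs_cov M t))"

definition joint_density :: "nat \<Rightarrow> ('d::finite, 'm::finite) lgssm \<Rightarrow> (nat \<Rightarrow> real^'m) \<Rightarrow> (nat \<Rightarrow> real^'d) \<Rightarrow> real" where
  "joint_density T M y s =
     (\<Prod>t=1..T. mvn_density (trans M t *v (s(0 := init_state M)) (t - 1) + trans_offset M t)
                            (trans_cov M t) (s t)) *
     (\<Prod>t\<in>obs_times M. mvn_density (readout M t *v s t + obs_offset M t) (obs_cov M t) (y t))"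

definition posterior_density :: "nat \<Rightarrow> ('d::finite, 'm::finite) lgssm \<Rightarrow> (nat \<Rightarrow> real^'m) \<Rightarrow> (nat \<Rightarrow> real^'d) \<Rightarrow> real" where
  "posterior_density T M y s =
     joint_density T M y s / (\<integral>s'. joint_density T M y s' \<partial>(\<Pi>\<^sub>M t\<in>{1..T}. lborel))"

definition is_MAP :: "nat \<Rightarrow> ('d::finite, 'm::finite) lgssm \<Rightarrow> (nat \<Rightarrow> real^'m) \<Rightarrow> (nat \<Rightarrow> real^'d) \<Rightarrow> bool" where
  "is_MAP T M y s \<longleftrightarrow> is_arg_max (posterior_density T M y) (\<lambda>s. s \<in> traj T) s"

text \<open>
  The model attached to a Levenberg--Marquardt step at the iterate s: the dynamics are
  linearized along s, with unit process noise, and s itself is observed (the data are y = s) with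
  noise variance 1/lam in every coordinate; for lam = 0 there are no observations.
\<close>

definition lm_lgssm ::
  "(nat \<Rightarrow> real^'d \<Rightarrow> real^'d) \<Rightarrow> real^'d \<Rightarrow> nat \<Rightarrow> real \<Rightarrow> (nat \<Rightarrow> real^'d) \<Rightarrow> ('d::finite, 'd) lgssm" where
  "lm_lgssm f s0 T lam s =
     (let x = (\<lambda>t. (s(0 := s0)) (t - 1));
          A = (\<lambda>t. jacobian (f t) (at (x t)))
      in \<lparr> init_state = s0,
           trans = A,
           trans_offset = (\<lambda>t. f t (x t) - A t *v x t),
           trans_cov = (\<lambda>t. mat 1),
           obs_times = (if lam = 0 then {} else {1..T}),
           readout = (\<lambda>t. mat 1),
           obs_offset = (\<lambda>t. 0),
           obs_cov = (\<lambda>t. mat (1 / lam)) \<rparr>)"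


section \<open>A parallel machine for exact real arithmetic\<close>

text \<open>
  A synchronous machine with shared memory: read-only input cells and one register per processor.
  In each unit-time step every active processor performs one binary arithmetic operation on cells
  as they were before the step (concurrent reads are allowed) and writes the result to its own
  register. \<open>None\<close> is the content of an unwritten register and the result of an illegal
  operation (a division by zero or a use of \<open>None\<close>), so no case distinction can be smuggled in
  through a total division. Programs are straight-line; their length is the running time.
\<close>

datatype 'i cell = Input 'i | Reg nat

datatype 'i instr =
    Const int
  | Add "'i cell" "'i cell"
  | Sub "'i cell" "'i cell"
  | Mul "'i cell" "'i cell"
  | Div "'i cell" "'i cell"

type_synonym 'i memory = "'i cell \<Rightarrow> real option"

type_synonym 'i program = "(nat \<rightharpoonup> 'i instr) list"

fun lift_op :: "(real \<Rightarrow> real \<Rightarrow> real) \<Rightarrow> real option \<Rightarrow> real option \<Rightarrow> real option" where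
  "lift_op g (Some x) (Some y) = Some (g x y)"
| "lift_op g _ _ = None"

fun exec_instr :: "'i memory \<Rightarrow> 'i instr \<Rightarrow> real option" where
  "exec_instr mem (Const c) = Some (of_int c)"
| "exec_instr mem (Add a b) = lift_op (+) (mem a) (mem b)"
| "exec_instr mem (Sub a b) = lift_op (-) (mem a) (mem b)"
| "exec_instr mem (Mul a b) = lift_op (*) (mem a) (mem b)"
| "exec_instr mem (Div a b) = (if mem b = Some 0 then None else lift_op (/) (mem a) (mem b))"

fun exec_step :: "(nat \<rightharpoonup> 'i instr) \<Rightarrow> 'i memory \<Rightarrow> 'i memory" where
  "exec_step st mem (Input i) = mem (Input i)"
| "exec_step st mem (Reg n) =
     (case st n of None \<Rightarrow> mem (Reg n) | Some ins \<Rightarrow> exec_instr mem ins)"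

fun init_memory :: "('i \<Rightarrow> real) \<Rightarrow> 'i memory" where
  "init_memory inp (Input i) = Some (inp i)"
| "init_memory inp (Reg n) = None"

definition run :: "'i program \<Rightarrow> ('i \<Rightarrow> real) \<Rightarrow> 'i memory" where
  "run prog inp = fold exec_step prog (init_memory inp)"

definition runs_on :: "nat \<Rightarrow> 'i program \<Rightarrow> bool" where
  "runs_on p prog \<longleftrightarrow> (\<forall>st\<in>set prog. dom st \<subseteq> {..<p})"

text \<open>The numerical data of an inference problem, one input cell per scalar entry. The set of
  observation times is not numerical data: it belongs to the shape of the problem, like T.\<close>

datatype ('d, 'm) lgssm_input =
    In_init 'd
  | In_trans nat 'd 'd
  | In_trans_offset nat 'd
  | In_trans_cov nat 'd 'd
  | In_readout nat 'm 'd
  | In_obs_offset nat 'm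
  | In_obs_cov nat 'm 'm
  | In_obs nat 'm

fun lgssm_data :: "('d::finite, 'm::finite) lgssm \<Rightarrow> (nat \<Rightarrow> real^'m) \<Rightarrow> ('d, 'm) lgssm_input \<Rightarrow> real" where
  "lgssm_data M y (In_init i) = init_state M $ i"
| "lgssm_data M y (In_trans t i j) = trans M t $ i $ j"
| "lgssm_data M y (In_trans_offset t i) = trans_offset M t $ i"
| "lgssm_data M y (In_trans_cov t i j) = trans_cov M t $ i $ j"
| "lgssm_data M y (In_readout t i j) = readout M t $ i $ j"
| "lgssm_data M y (In_obs_offset t i) = obs_offset M t $ i"
| "lgssm_data M y (In_obs_cov t i j) = obs_cov M t $ i $ j"
| "lgssm_data M y (In_obs t i) = y t $ i"

text \<open>The program is correct for horizon T and observation times K: for every model of this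
  shape and all data, the MAP estimate exists, is unique, and is left in the registers
  \<open>out\<close>.\<close>

definition computes_MAP ::
  "nat \<Rightarrow> nat set \<Rightarrow> ('d::finite, 'm::finite) lgssm_input program \<Rightarrow> (nat \<Rightarrow> 'd \<Rightarrow> nat) \<Rightarrow> bool" where
  "computes_MAP T K prog out \<longleftrightarrow>
     (\<forall>(M :: ('d, 'm) lgssm) y. valid_lgssm T M \<and> obs_times M = K \<longrightarrow>
        (\<exists>s. Collect (is_MAP T M y) = {s} \<and>
             (\<forall>t\<in>{1..T}. \<forall>i. run prog (lgssm_data M y) (Reg (out t i)) = Some (s t $ i))))"

end

theory Submission
  imports Defs "HOL-Probability.Distributions"
begin

text \<open>
  The first claim is an identity of objectives. The posterior density of a linear Gaussian model is
  \<open>exp (- cost)\<close> up to a positive constant, where the cost is the sum of squared innovations and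
  squared data misfits, weighted by the inverse covariances (\<open>is_MAP_iff_is_arg_min\<close>). For the model
  attached to a Levenberg--Marquardt step this cost, at the trajectory \<open>s + \<Delta>\<close>, is the
  Levenberg--Marquardt objective at \<open>\<Delta>\<close> (\<open>map_cost_lm_lgssm\<close>). The analytic input is that the
  evidence is finite and positive (\<open>evidence_pos\<close>): with evidence 0 the quotient that defines the
  posterior density would be constantly 0, and every trajectory would be a mode of it.

  For the second claim, the cost is a sum over \<open>t\<close> of quadratic functions of the neighbouring states
  \<open>s (t - 1)\<close> and \<open>s t\<close>. Minimizing over the state shared by two adjacent pieces leaves again a
  quadratic function of the two outer states, a Schur complement (\<open>qval_complete_square\<close>). Joining
  pieces along a balanced binary tree therefore summarizes the whole path in a number of rounds that
  is logarithmic in \<open>T\<close>; going back down the tree, every middle state is the explicit minimizer for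
  its two outer states, which are already known. This is \<open>path_minimizer_computable\<close>.

  Such an elimination must never divide by zero, on any instance. Every stage is positive definite
  in its right state, since the process noise is nondegenerate, and jointly positive semidefinite;
  joins keep both properties (\<open>convex_quad_join\<close>). Hence each pivot is a positive definite matrix
  plus a positive semidefinite one. It has the fixed size D, so Cramer's rule inverts it in a
  constant number of steps and divides by its nonzero determinant only.

  The tree recursion is not scheduled by hand. It only has to yield, for every coordinate of the
  result, an arithmetic expression of logarithmic depth; with one processor per subexpression, any
  finite set of expressions is evaluated in as many steps as it is deep (\<open>program_of_exprs\<close>).
\<close>

section \<open>Arithmetic expressions as parallel programs\<close>

datatype arith = Plus | Minus | Times | Divide

fun instr_of :: "arith \<Rightarrow> 'i cell \<Rightarrow> 'i cell \<Rightarrow> 'i instr" where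
  "instr_of Plus = Add"
| "instr_of Minus = Sub"
| "instr_of Times = Mul"
| "instr_of Divide = Div"

fun apply_arith :: "arith \<Rightarrow> real option \<Rightarrow> real option \<Rightarrow> real option" where
  "apply_arith Plus x y = lift_op (+) x y"
| "apply_arith Minus x y = lift_op (-) x y"
| "apply_arith Times x y = lift_op (*) x y"
| "apply_arith Divide x y = (if y = Some 0 then None else lift_op (/) x y)"

lemma exec_instr_of: "exec_instr mem (instr_of ar a b) = apply_arith ar (mem a) (mem b)"
  by (cases ar) auto

text \<open>
  Depth counts the steps after which a value can be read: input cells are readable at once, whereas a
  constant first has to be written into a register.
\<close>

datatype 'i expr = Leaf 'i | Lit int | Node arith "'i expr" "'i expr"

fun depth :: "'i expr \<Rightarrow> nat" where
  "depth (Leaf i) = 0"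
| "depth (Lit c) = 1"
| "depth (Node ar a b) = Suc (max (depth a) (depth b))"

fun denote :: "('i \<Rightarrow> real) \<Rightarrow> 'i expr \<Rightarrow> real option" where
  "denote inp (Leaf i) = Some (inp i)"
| "denote inp (Lit c) = Some (of_int c)"
| "denote inp (Node ar a b) = apply_arith ar (denote inp a) (denote inp b)"

fun subexprs :: "'i expr \<Rightarrow> 'i expr set" where
  "subexprs (Leaf i) = {Leaf i}"
| "subexprs (Lit c) = {Lit c}"
| "subexprs (Node ar a b) = insert (Node ar a b) (subexprs a \<union> subexprs b)"

lemma finite_subexprs: "finite (subexprs e)"
  by (induction e) auto

lemma subexprs_refl: "e \<in> subexprs e"
  by (cases e) auto

lemma subexprs_closed: "Node ar a b \<in> subexprs e \<Longrightarrow> a \<in> subexprs e \<and> b \<in> subexprs e"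
  by (induction e) (auto simp: subexprs_refl)

text \<open>
  Every subexpression gets a processor of its own, and all time steps are the same: each processor
  recomputes its node from the current contents of the cells of the two children. Whatever was in
  the registers before, after k rounds the nodes of depth at most k carry their values and keep
  them, so no schedule is needed and the running time is the depth.
\<close>

lemma program_of_exprs:
  fixes E :: "'i expr set"
  assumes "finite E" and depth: "\<And>e. e \<in> E \<Longrightarrow> depth e \<le> n"
  obtains p prog reg where "runs_on p prog" "length prog = n"
    "\<And>e inp. e \<in> E \<Longrightarrow> 0 < depth e \<Longrightarrow> run prog inp (Reg (reg e)) = denote inp e"
proof -
  define N where "N = (\<Union>e\<in>E. subexprs e)"
  have finN: "finite N"
    unfolding N_def using \<open>finite E\<close> by (auto simp: finite_subexprs)
  have EN: "E \<subseteq> N"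
    unfolding N_def using subexprs_refl by fast
  have closed: "a \<in> N \<and> b \<in> N" if "Node ar a b \<in> N" for ar a b
    using that subexprs_closed unfolding N_def by blast
  obtain reg where reg: "bij_betw reg N {..<card N}"
    using ex_bij_betw_finite_nat[OF finN] by (auto simp: atLeast0LessThan)
  define cell where "cell = (\<lambda>e. case e of Leaf i \<Rightarrow> Input i | _ \<Rightarrow> Reg (reg e))"
  define node where "node = (\<lambda>e. case e of Leaf i \<Rightarrow> None | Lit c \<Rightarrow> Some (Const c)
    | Node ar a b \<Rightarrow> Some (instr_of ar (cell a) (cell b)))"
  define st where "st = (\<lambda>k. if k < card N then node (inv_into N reg k) else None)"
  have st: "st (reg e) = node e" if "e \<in> N" for e
    using that reg bij_betw_apply[OF reg that] by (simp add: st_def bij_betw_inv_into_left)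
  have inv: "\<forall>e\<in>N. depth e \<le> k \<longrightarrow> run (replicate k st) inp (cell e) = denote inp e" for k inp
  proof (induction k)
    case 0
    show ?case
    proof (intro ballI impI)
      fix e :: "'i expr" assume "depth e \<le> 0"
      then show "run (replicate 0 st) inp (cell e) = denote inp e"
        by (cases e) (auto simp: run_def cell_def)
    qed
  next
    case (Suc k)
    have step: "run (replicate (Suc k) st) inp = exec_step st (run (replicate k st) inp)"
      by (simp add: run_def replicate_append_same[symmetric] del: replicate.simps)
    show ?case
    proof (intro ballI impI)
      fix e assume e: "e \<in> N" "depth e \<le> Suc k"
      show "run (replicate (Suc k) st) inp (cell e) = denote inp e"
      proof (cases e)
        case (Leaf i)
        have "run (replicate j st) inp (Input i) = Some (inp i)" for j
          unfolding run_def
          by (induction j) (simp_all add: replicate_append_same[symmetric] del: replicate.simps(2))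
        then show ?thesis
          using Leaf by (simp add: cell_def del: replicate.simps)
      next
        case (Lit c)
        then show ?thesis
          using st[OF e(1)] unfolding step by (simp add: cell_def node_def)
      next
        case (Node ar a b)
        have "a \<in> N" "b \<in> N" "depth a \<le> k" "depth b \<le> k"
          using closed[of ar a b] e unfolding Node by auto
        then have "run (replicate k st) inp (cell a) = denote inp a"
          "run (replicate k st) inp (cell b) = denote inp b"
          using Suc.IH by blast+
        then show ?thesis
          using st[OF e(1)] Node unfolding step by (simp add: cell_def node_def exec_instr_of)
      qed
    qed
  qed
  show ?thesis
  proof
    show "runs_on (card N) (replicate n st)"
      by (auto simp: runs_on_def st_def split: if_splits)
    show "length (replicate n st) = n"
      by simp
    show "run (replicate n st) inp (Reg (reg e)) = denote inp e"
      if "e \<in> E" "0 < depth e" for e inp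
    proof -
      have "cell e = Reg (reg e)"
        using that(2) by (cases e) (auto simp: cell_def)
      then show ?thesis
        using inv depth[OF that(1)] that(1) EN by (metis subsetD)
    qed
  qed
qed

section \<open>Quantities computable in bounded parallel time\<close>

text \<open>
  \<open>W\<close> is a class of problem instances and \<open>inp w\<close> the input cells of the instance \<open>w\<close>. A
  quantity is computable in time \<open>n\<close> if one expression of depth at most \<open>n\<close> gives its value on every
  instance; in particular that expression never divides by zero on \<open>W\<close>. A quantity that is needed
  twice is expanded twice, which costs processors but no time.
\<close>

locale instances =
  fixes inp :: "'w \<Rightarrow> 'i \<Rightarrow> real" and W :: "'w set"
begin

definition computable :: "nat \<Rightarrow> ('w \<Rightarrow> real) \<Rightarrow> bool" where
  "computable n g \<longleftrightarrow> (\<exists>e. depth e \<le> n \<and> (\<forall>w\<in>W. denote (inp w) e = Some (g w)))"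

definition vec_computable :: "nat \<Rightarrow> ('w \<Rightarrow> real^'n) \<Rightarrow> bool" where
  "vec_computable n v \<longleftrightarrow> (\<forall>i. computable n (\<lambda>w. v w $ i))"

definition mat_computable :: "nat \<Rightarrow> ('w \<Rightarrow> real^'n^'k) \<Rightarrow> bool" where
  "mat_computable n A \<longleftrightarrow> (\<forall>i j. computable n (\<lambda>w. A w $ i $ j))"

lemma computable_mono: "computable n g \<Longrightarrow> n \<le> m \<Longrightarrow> computable m g"
  unfolding computable_def by (meson order_trans)

lemma vec_computable_mono: "vec_computable n v \<Longrightarrow> n \<le> m \<Longrightarrow> vec_computable m v"
  unfolding vec_computable_def using computable_mono by blast

lemma mat_computable_mono: "mat_computable n A \<Longrightarrow> n \<le> m \<Longrightarrow> mat_computable m A"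
  unfolding mat_computable_def using computable_mono by blast

lemma computable_input: "computable 0 (\<lambda>w. inp w i)"
  unfolding computable_def by (intro exI[of _ "Leaf i"]) simp

lemma computable_const: "computable 1 (\<lambda>w. of_int c)"
  unfolding computable_def by (intro exI[of _ "Lit c"]) simp

lemma computable_cong: "computable n g \<Longrightarrow> (\<And>w. w \<in> W \<Longrightarrow> g w = h w) \<Longrightarrow> computable n h"
  unfolding computable_def by auto

lemma mat_computable_cong:
  assumes "mat_computable n A" "\<And>w. w \<in> W \<Longrightarrow> A w = B w"
  shows "mat_computable n B"
  unfolding mat_computable_def
proof (intro allI)
  fix i j
  have "computable n (\<lambda>w. A w $ i $ j)"
    using assms(1) by (simp add: mat_computable_def)
  then show "computable n (\<lambda>w. B w $ i $ j)"
    by (rule computable_cong) (simp add: assms(2))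
qed

lemma computable_binary:
  assumes "computable n g" "computable n h"
    and "\<And>w. w \<in> W \<Longrightarrow> apply_arith ar (Some (g w)) (Some (h w)) = Some (k w)"
  shows "computable (Suc n) k"
proof -
  obtain a b where "depth a \<le> n" "depth b \<le> n"
    "\<forall>w\<in>W. denote (inp w) a = Some (g w)" "\<forall>w\<in>W. denote (inp w) b = Some (h w)"
    using assms(1,2) unfolding computable_def by blast
  then show ?thesis
    unfolding computable_def using assms(3) by (intro exI[of _ "Node ar a b"]) simp
qed

lemma computable_add: "computable n g \<Longrightarrow> computable n h \<Longrightarrow> computable (Suc n) (\<lambda>w. g w + h w)"
  by (rule computable_binary[where ar = Plus]) auto

lemma computable_diff: "computable n g \<Longrightarrow> computable n h \<Longrightarrow> computable (Suc n) (\<lambda>w. g w - h w)"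
  by (rule computable_binary[where ar = Minus]) auto

lemma computable_mult: "computable n g \<Longrightarrow> computable n h \<Longrightarrow> computable (Suc n) (\<lambda>w. g w * h w)"
  by (rule computable_binary[where ar = Times]) auto

lemma computable_divide:
  "computable n g \<Longrightarrow> computable n h \<Longrightarrow> (\<And>w. w \<in> W \<Longrightarrow> h w \<noteq> 0) \<Longrightarrow>
    computable (Suc n) (\<lambda>w. g w / h w)"
  by (rule computable_binary[where ar = Divide and g = g and h = h]) auto

lemma computable_sum:
  assumes "finite A" and "\<And>x. x \<in> A \<Longrightarrow> computable n (g x)"
  shows "computable (n + card A + 1) (\<lambda>w. \<Sum>x\<in>A. g x w)"
  using assms
proof (induction A rule: finite_induct)
  case empty
  show ?case
    using computable_mono[OF computable_const[of 0]] by simp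
next
  case (insert x A)
  have "computable (n + card A + 1) (g x)"
    by (rule computable_mono[of n]) (use insert in auto)
  from computable_add[OF this insert.IH] insert show ?case
    by simp
qed

lemma computable_prod:
  assumes "finite A" and "\<And>x. x \<in> A \<Longrightarrow> computable n (g x)"
  shows "computable (n + card A + 1) (\<lambda>w. \<Prod>x\<in>A. g x w)"
  using assms
proof (induction A rule: finite_induct)
  case empty
  show ?case
    using computable_mono[OF computable_const[of 1]] by simp
next
  case (insert x A)
  have "computable (n + card A + 1) (g x)"
    by (rule computable_mono[of n]) (use insert in auto)
  from computable_mult[OF this insert.IH] insert show ?case
    by simp
qed

lemma vec_computable_add:
  "vec_computable n u \<Longrightarrow> vec_computable n v \<Longrightarrow> vec_computable (Suc n) (\<lambda>w. u w + v w)"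
  unfolding vec_computable_def by (simp add: computable_add)

lemma vec_computable_diff:
  "vec_computable n u \<Longrightarrow> vec_computable n v \<Longrightarrow> vec_computable (Suc n) (\<lambda>w. u w - v w)"
  unfolding vec_computable_def by (simp add: computable_diff)

lemma mat_computable_add:
  "mat_computable n A \<Longrightarrow> mat_computable n B \<Longrightarrow> mat_computable (Suc n) (\<lambda>w. A w + B w)"
  unfolding mat_computable_def by (simp add: computable_add)

lemma mat_computable_diff:
  "mat_computable n A \<Longrightarrow> mat_computable n B \<Longrightarrow> mat_computable (Suc n) (\<lambda>w. A w - B w)"
  unfolding mat_computable_def by (simp add: computable_diff)

lemma mat_computable_transpose: "mat_computable n A \<Longrightarrow> mat_computable n (\<lambda>w. transpose (A w))"
  unfolding mat_computable_def by (simp add: transpose_def)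

lemma mat_vec_computable:
  fixes A :: "'w \<Rightarrow> real^'n^'k"
  assumes "mat_computable n A" "vec_computable n v"
  shows "vec_computable (n + CARD('n) + 2) (\<lambda>w. A w *v v w)"
  unfolding vec_computable_def
proof
  fix i
  have "computable (Suc n + CARD('n) + 1) (\<lambda>w. \<Sum>j\<in>UNIV. A w $ i $ j * v w $ j)"
    by (rule computable_sum, simp, rule computable_mult)
      (use assms in \<open>simp_all add: mat_computable_def vec_computable_def\<close>)
  then show "computable (n + CARD('n) + 2) (\<lambda>w. (A w *v v w) $ i)"
    by (simp add: matrix_vector_mult_def)
qed

lemma mat_mat_computable:
  fixes A :: "'w \<Rightarrow> real^'n^'k" and B :: "'w \<Rightarrow> real^'l^'n"
  assumes "mat_computable n A" "mat_computable n B"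
  shows "mat_computable (n + CARD('n) + 2) (\<lambda>w. A w ** B w)"
  unfolding mat_computable_def
proof (intro allI)
  fix i j
  have "computable (Suc n + CARD('n) + 1) (\<lambda>w. \<Sum>k\<in>UNIV. A w $ i $ k * B w $ k $ j)"
    by (rule computable_sum, simp, rule computable_mult)
      (use assms in \<open>simp_all add: mat_computable_def\<close>)
  then show "computable (n + CARD('n) + 2) (\<lambda>w. (A w ** B w) $ i $ j)"
    by (simp add: matrix_matrix_mult_def)
qed

lemma computable_det:
  fixes A :: "'w \<Rightarrow> real^'n^'n"
  assumes "mat_computable n A"
  shows "computable (n + CARD('n) + fact CARD('n) + 3) (\<lambda>w. det (A w))"
proof -
  have card: "card {p. p permutes (UNIV :: 'n set)} = fact CARD('n)"
    by (rule card_permutations) auto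
  have "computable (Suc (n + CARD('n) + 1) + card {p. p permutes (UNIV :: 'n set)} + 1)
    (\<lambda>w. \<Sum>p\<in>{p. p permutes (UNIV :: 'n set)}. of_int (sign p) * (\<Prod>i\<in>UNIV. A w $ i $ p i))"
  proof (rule computable_sum)
    fix p :: "'n \<Rightarrow> 'n"
    have "computable (n + CARD('n) + 1) (\<lambda>w. of_int (sign p))"
      by (rule computable_mono[OF computable_const]) simp
    moreover have "computable (n + CARD('n) + 1) (\<lambda>w. \<Prod>i\<in>UNIV. A w $ i $ p i)"
      using assms by (intro computable_prod) (auto simp: mat_computable_def)
    ultimately show "computable (Suc (n + CARD('n) + 1))
        (\<lambda>w. of_int (sign p) * (\<Prod>i\<in>UNIV. A w $ i $ p i))"
      by (rule computable_mult)
  qed (simp add: finite_permutations)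
  moreover have "Suc (n + CARD('n) + 1) + fact CARD('n) + 1 = n + CARD('n) + fact CARD('n) + 3"
    by simp
  ultimately show ?thesis
    unfolding det_def card by (simp only:)
qed

end

lemma matrix_inv_inverse:
  fixes A :: "real^'n^'n"
  assumes "det A \<noteq> 0"
  shows "A ** matrix_inv A = mat 1" "matrix_inv A ** A = mat 1"
proof -
  have "\<exists>B. A ** B = mat 1 \<and> B ** A = mat 1"
    using assms invertible_det_nz[of A] by (simp add: invertible_def)
  from someI_ex[OF this] show "A ** matrix_inv A = mat 1" "matrix_inv A ** A = mat 1"
    unfolding matrix_inv_def by blast+
qed

lemma matrix_inv_cramer:
  fixes A :: "real^'n^'n"
  assumes "det A \<noteq> 0"
  shows "matrix_inv A $ i $ j = det (\<chi> k l. if l = i then axis j 1 $ k else A $ k $ l) / det A"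
proof -
  have "A *v (matrix_inv A *v axis j 1) = axis j 1"
    using matrix_inv_inverse(1)[OF assms] by (simp add: matrix_vector_mul_assoc)
  then have "matrix_inv A *v axis j 1
    = (\<chi> k. det (\<chi> i l. if l = k then axis j 1 $ i else A $ i $ l) / det A)"
    using cramer[OF assms] by blast
  moreover have "(matrix_inv A *v axis j 1) $ i = matrix_inv A $ i $ j"
    by (simp add: matrix_vector_mult_def axis_def if_distrib cong: if_cong)
  ultimately show ?thesis
    by (simp only: vec_lambda_beta)
qed

text \<open>
  By Cramer's rule an inverse of fixed size costs a fixed number of steps. Unlike elimination with
  pivoting it needs no comparison, and it divides by the determinant only.
\<close>

lemma (in instances) mat_computable_inverse:
  fixes A :: "'w \<Rightarrow> real^'n^'n"
  assumes A: "mat_computable n A" and nz: "\<And>w. w \<in> W \<Longrightarrow> det (A w) \<noteq> 0"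
  shows "mat_computable (n + CARD('n) + fact CARD('n) + 5) (\<lambda>w. matrix_inv (A w))"
  unfolding mat_computable_def
proof (intro allI)
  fix i j
  let ?B = "\<lambda>w. (\<chi> k l. if l = i then axis j 1 $ k else A w $ k $ l) :: real^'n^'n"
  have "computable (Suc n) (\<lambda>w. ?B w $ k $ l)" for k l
  proof (cases "l = i")
    case True
    have "computable (Suc n) (\<lambda>w. of_int (if j = k then 1 else 0))"
      by (rule computable_mono[OF computable_const]) simp
    then show ?thesis
      by (rule computable_cong) (use True in \<open>auto simp: axis_def\<close>)
  next
    case False
    then show ?thesis
      using A computable_mono[of n _ "Suc n"] by (simp add: mat_computable_def)
  qed
  then have "computable (Suc n + CARD('n) + fact CARD('n) + 3) (\<lambda>w. det (?B w))"
    by (intro computable_det) (simp add: mat_computable_def)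
  moreover have "computable (Suc n + CARD('n) + fact CARD('n) + 3) (\<lambda>w. det (A w))"
    by (rule computable_mono[OF computable_det[OF A]]) simp
  ultimately have "computable (Suc (Suc n + CARD('n) + fact CARD('n) + 3)) (\<lambda>w. det (?B w) / det (A w))"
    using nz by (rule computable_divide)
  moreover have "Suc (Suc n + CARD('n) + fact CARD('n) + 3) = n + CARD('n) + fact CARD('n) + 5"
    by simp
  ultimately have "computable (n + CARD('n) + fact CARD('n) + 5) (\<lambda>w. det (?B w) / det (A w))"
    by (simp only:)
  then show "computable (n + CARD('n) + fact CARD('n) + 5) (\<lambda>w. matrix_inv (A w) $ i $ j)"
    by (rule computable_cong) (simp add: matrix_inv_cramer nz)
qed

section \<open>Positive definite matrices\<close>

lemma inner_matrix_transpose: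
  fixes A :: "real^'n^'k"
  shows "x \<bullet> (A *v y) = (transpose A *v x) \<bullet> y"
  by (simp add: dot_lmul_matrix[symmetric])

lemma inner_symmetric_matrix:
  fixes A :: "real^'n^'n"
  assumes "transpose A = A"
  shows "x \<bullet> (A *v y) = y \<bullet> (A *v x)"
  by (subst inner_matrix_transpose) (simp add: assms inner_commute)

lemma transpose_add: "transpose (A + B) = transpose A + transpose (B :: real^'n^'k)"
  by (simp add: transpose_def vec_eq_iff)

lemma transpose_diff: "transpose (A - B) = transpose A - transpose (B :: real^'n^'k)"
  by (simp add: transpose_def vec_eq_iff)

lemma matrix_vector_mult_minus: "(- A) *v x = - ((A :: real^'n^'k) *v x)"
  by (simp add: matrix_vector_mult_def vec_eq_iff sum_negf)

lemma mat_mult_vec: "mat c *v x = c *\<^sub>R (x :: real^'n)"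
  by (simp add: vec_eq_iff matrix_vector_mult_def mat_def if_distrib if_distribR cong: if_cong)

lemma pos_def_matrix_transpose: "pos_def_matrix A \<Longrightarrow> transpose A = A"
  by (simp add: pos_def_matrix_def)

lemma pos_def_matrix_pos: "pos_def_matrix A \<Longrightarrow> x \<noteq> 0 \<Longrightarrow> 0 < x \<bullet> (A *v x)"
  by (simp add: pos_def_matrix_def)

lemma pos_def_matrix_nonneg: "pos_def_matrix A \<Longrightarrow> 0 \<le> x \<bullet> (A *v x)"
  by (cases "x = 0") (auto simp: pos_def_matrix_def less_imp_le)

lemma pos_def_matrix_eq_0_iff: "pos_def_matrix A \<Longrightarrow> x \<bullet> (A *v x) = 0 \<longleftrightarrow> x = 0"
  by (metis inner_zero_left order_less_irrefl pos_def_matrix_pos)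

lemma pos_def_matrix_mat:
  assumes "c > 0"
  shows "pos_def_matrix (mat c :: real^'n^'n)"
  using assms by (auto simp: pos_def_matrix_def transpose_mat mat_mult_vec)

lemma pos_def_matrix_add:
  assumes "pos_def_matrix A" "transpose B = B" "\<And>x. 0 \<le> x \<bullet> (B *v x)"
  shows "pos_def_matrix (A + B)"
  using assms
  by (auto simp: pos_def_matrix_def transpose_add matrix_vector_mult_add_rdistrib inner_add_right
      intro: add_pos_nonneg)

lemma pos_def_matrix_det_nz:
  fixes A :: "real^'n^'n"
  assumes "pos_def_matrix A"
  shows "det A \<noteq> 0"
proof -
  have "inj ((*v) A)"
  proof (rule injI)
    fix x y assume "A *v x = A *v y"
    then have "(x - y) \<bullet> (A *v (x - y)) = 0"
      by (simp add: matrix_vector_mult_diff_distrib)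
    then show "x = y"
      using pos_def_matrix_eq_0_iff[OF assms] by simp
  qed
  then show ?thesis
    using det_nz_iff_inj[OF matrix_vector_mul_linear, of A] by (simp add: matrix_of_matrix_vector_mul)
qed

text \<open>
  The segment from the identity to \<open>A\<close> stays inside the positive definite matrices, so the
  determinant cannot change sign along it.
\<close>

lemma pos_def_matrix_det_pos:
  fixes A :: "real^'n^'n"
  assumes A: "pos_def_matrix A"
  shows "0 < det A"
proof (rule ccontr)
  assume neg: "\<not> 0 < det A"
  let ?B = "\<lambda>t. (\<chi> i j. (1 - t) * (mat 1 :: real^'n^'n) $ i $ j + t * A $ i $ j) :: real^'n^'n"
  have B: "?B t *v x = (1 - t) *\<^sub>R x + t *\<^sub>R (A *v x)" for t x
  proof -
    have "(?B t *v x) $ i = (1 - t) * ((mat 1 *v x) $ i) + t * ((A *v x) $ i)" for i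
      by (simp only: matrix_vector_mult_def vec_lambda_beta)
        (simp add: sum_distrib_left sum.distrib[symmetric] distrib_right mult.assoc)
    then show ?thesis
      by (simp add: vec_eq_iff)
  qed
  have pd: "pos_def_matrix (?B t)" if "0 \<le> t" "t \<le> 1" for t
  proof -
    have "A $ i $ j = A $ j $ i" for i j
      using pos_def_matrix_transpose[OF A] by (metis transpose_def vec_lambda_beta)
    then have "transpose (?B t) = ?B t"
      by (auto simp: transpose_def vec_eq_iff mat_def)
    moreover have "0 < x \<bullet> (?B t *v x)" if "x \<noteq> 0" for x
    proof (cases "t = 1")
      case True
      then show ?thesis
        unfolding B using pos_def_matrix_pos[OF A that] by simp
    next
      case False
      then have "0 < (1 - t) * (x \<bullet> x)"
        using \<open>t \<le> 1\<close> that by (simp add: inner_gt_zero_iff)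
      moreover have "0 \<le> t * (x \<bullet> (A *v x))"
        using \<open>0 \<le> t\<close> pos_def_matrix_nonneg[OF A] by simp
      ultimately show ?thesis
        unfolding B by (simp add: inner_add_right)
    qed
    ultimately show ?thesis
      by (simp add: pos_def_matrix_def)
  qed
  have "continuous_on {0..1} (\<lambda>t. det (?B t))"
    unfolding det_def by (simp, intro continuous_intros)
  moreover have "?B 0 = mat 1" "?B 1 = A"
    by (auto simp: vec_eq_iff)
  ultimately obtain t where "0 \<le> t" "t \<le> 1" "det (?B t) = 0"
    using IVT2'[of "\<lambda>t. det (?B t)" 1 0 0] neg by (auto simp: not_less)
  then show False
    using pos_def_matrix_det_nz[OF pd] by blast
qed

lemma pos_def_matrix_inv:
  fixes A :: "real^'n^'n"
  assumes A: "pos_def_matrix A"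
  shows "pos_def_matrix (matrix_inv A)"
proof -
  note inv = matrix_inv_inverse[OF pos_def_matrix_det_nz[OF A]]
  have "transpose (matrix_inv A) ** A = mat 1"
    using arg_cong[OF inv(1), of transpose]
    by (simp add: matrix_transpose_mul pos_def_matrix_transpose[OF A] transpose_mat)
  then have "transpose (matrix_inv A) = matrix_inv A"
    by (metis inv(1) matrix_mul_assoc matrix_mul_lid matrix_mul_rid)
  moreover have "0 < x \<bullet> (matrix_inv A *v x)" if "x \<noteq> 0" for x
  proof -
    let ?y = "matrix_inv A *v x"
    have x: "A *v ?y = x"
      using inv(1) by (simp add: matrix_vector_mul_assoc)
    then have "?y \<noteq> 0"
      using that by auto
    then show ?thesis
      using pos_def_matrix_pos[OF A, of ?y] x by (simp add: inner_commute)
  qed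
  ultimately show ?thesis
    by (simp add: pos_def_matrix_def)
qed

text \<open>By homogeneity it suffices to bound the form on the unit sphere, which is compact.\<close>

lemma pos_def_matrix_coercive:
  fixes A :: "real^'n^'n"
  assumes A: "pos_def_matrix A"
  obtains c where "0 < c" "\<And>x. c * (norm x)\<^sup>2 \<le> x \<bullet> (A *v x)"
proof -
  let ?q = "\<lambda>x. x \<bullet> (A *v x)"
  have "continuous_on (sphere 0 1) ?q"
    by (intro continuous_intros matrix_vector_mult_linear_continuous_on)
  moreover have "sphere (0 :: real^'n) 1 \<noteq> {}"
    by simp
  ultimately obtain u where u: "u \<in> sphere 0 1" "\<And>x. x \<in> sphere 0 1 \<Longrightarrow> ?q u \<le> ?q x"
    using continuous_attains_inf[of "sphere 0 1" ?q] compact_sphere by blast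
  show ?thesis
  proof
    have "u \<noteq> 0"
      using u(1) by auto
    then show "0 < ?q u"
      by (rule pos_def_matrix_pos[OF A])
    show "?q u * (norm x)\<^sup>2 \<le> ?q x" for x
    proof (cases "x = 0")
      case False
      define y where "y = x /\<^sub>R norm x"
      have "?q u \<le> ?q y"
        using False by (intro u(2)) (simp add: y_def)
      moreover have "x = norm x *\<^sub>R y"
        using False by (simp add: y_def)
      then have "?q x = (norm x)\<^sup>2 * ?q y"
        by (metis (no_types, lifting) inner_scaleR_left inner_scaleR_right
            matrix_vector_mult_scaleR mult.assoc power2_eq_square)
      ultimately show ?thesis
        by (simp add: mult.commute mult_right_mono)
    qed simp
  qed
qed

section \<open>Quadratic costs between two states\<close>

record ('d::finite) quad =
  qll :: "real^'d^'d"
  qlr :: "real^'d^'d"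
  qrr :: "real^'d^'d"
  lin_l :: "real^'d"
  lin_r :: "real^'d"

definition qval :: "('d::finite) quad \<Rightarrow> real^'d \<Rightarrow> real^'d \<Rightarrow> real" where
  "qval q x z = (x \<bullet> (qll q *v x)) / 2 + x \<bullet> (qlr q *v z) + (z \<bullet> (qrr q *v z)) / 2
     - lin_l q \<bullet> x - lin_r q \<bullet> z"

definition homogeneous :: "('d::finite) quad \<Rightarrow> 'd quad" where
  "homogeneous q = q\<lparr>lin_l := 0, lin_r := 0\<rparr>"

text \<open>
  Semidefinite in both states together and definite in the right one. The asymmetry is that of a
  transition: its noise charges the new state, while a singular transition matrix may ignore the
  old one. Together the two conditions make every pivot definite, and joins preserve them.
\<close>

definition convex_quad :: "('d::finite) quad \<Rightarrow> bool" where
  "convex_quad q \<longleftrightarrow> transpose (qll q) = qll q \<and> pos_def_matrix (qrr q) \<and>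
     (\<forall>x z. 0 \<le> qval (homogeneous q) x z)"

definition pivot :: "('d::finite) quad \<Rightarrow> 'd quad \<Rightarrow> real^'d^'d" where
  "pivot q p = qrr q + qll p"

definition best_middle :: "('d::finite) quad \<Rightarrow> 'd quad \<Rightarrow> real^'d \<Rightarrow> real^'d \<Rightarrow> real^'d" where
  "best_middle q p x z = matrix_inv (pivot q p) *v
     (lin_r q + lin_l p - transpose (qlr q) *v x - qlr p *v z)"

text \<open>The Schur complement that remains when the state shared by \<open>q\<close> and \<open>p\<close> is eliminated.\<close>

definition quad_join :: "('d::finite) quad \<Rightarrow> 'd quad \<Rightarrow> 'd quad" where
  "quad_join q p =
    (let D = matrix_inv (pivot q p); e = lin_r q + lin_l p in
     \<lparr> qll = qll q - qlr q ** D ** transpose (qlr q),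
       qlr = mat 0 - qlr q ** D ** qlr p,
       qrr = qrr p - transpose (qlr p) ** D ** qlr p,
       lin_l = lin_l q - qlr q *v (D *v e),
       lin_r = lin_r p - transpose (qlr p) *v (D *v e) \<rparr>)"

definition join_const :: "('d::finite) quad \<Rightarrow> 'd quad \<Rightarrow> real" where
  "join_const q p = - ((lin_r q + lin_l p) \<bullet> (matrix_inv (pivot q p) *v (lin_r q + lin_l p))) / 2"

text \<open>
  Completing the square in the middle state. The constant \<open>join_const\<close> depends on neither outer
  state, so it never has to be computed.
\<close>

lemma qval_complete_square:
  assumes pd: "pos_def_matrix (pivot q p)"
  shows "qval q x m + qval p m z = qval (quad_join q p) x z + join_const q p
    + (m - best_middle q p x z) \<bullet> (pivot q p *v (m - best_middle q p x z)) / 2"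
proof -
  define P where "P = pivot q p"
  define D where "D = matrix_inv P"
  define e where "e = lin_r q + lin_l p"
  define a where "a = x v* qlr q"
  define b where "b = qlr p *v z"
  define u where "u = e - a - b"
  have Psym: "transpose P = P"
    using pd pos_def_matrix_transpose P_def by blast
  have Dsym: "transpose D = D"
    using pos_def_matrix_transpose[OF pos_def_matrix_inv[OF pd]] by (simp add: D_def P_def)
  have sym: "f \<bullet> (D *v g) = g \<bullet> (D *v f)" for f g
    by (rule inner_symmetric_matrix[OF Dsym])
  have "P ** D = mat 1"
    using matrix_inv_inverse(1)[OF pos_def_matrix_det_nz[OF pd]] by (simp add: P_def D_def)
  then have PD: "P *v (D *v f) = f" for f
    by (simp add: matrix_vector_mul_assoc)
  have bm: "best_middle q p x z = D *v u"
    by (simp add: best_middle_def u_def e_def a_def b_def D_def P_def)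
  have "(m - D *v u) \<bullet> (P *v (m - D *v u))
    = m \<bullet> (P *v m) - m \<bullet> u - (D *v u) \<bullet> (P *v m) + (D *v u) \<bullet> u"
    by (simp add: matrix_vector_mult_diff_distrib inner_diff_left inner_diff_right PD)
  also have "(D *v u) \<bullet> (P *v m) = m \<bullet> u"
    by (subst inner_symmetric_matrix[OF Psym]) (simp add: PD)
  finally have square: "(m - D *v u) \<bullet> (P *v (m - D *v u)) / 2
    = m \<bullet> (P *v m) / 2 - m \<bullet> u + u \<bullet> (D *v u) / 2"
    by (simp add: inner_commute)
  have uDu: "u \<bullet> (D *v u) = e \<bullet> (D *v e) - 2 * (a \<bullet> (D *v e)) - 2 * (b \<bullet> (D *v e))
    + a \<bullet> (D *v a) + 2 * (a \<bullet> (D *v b)) + b \<bullet> (D *v b)"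
    using sym[of e a] sym[of e b] sym[of b a]
    by (simp add: u_def matrix_vector_mult_diff_distrib inner_diff_left inner_diff_right)
  have mu: "m \<bullet> u = lin_r q \<bullet> m + lin_l p \<bullet> m - a \<bullet> m - m \<bullet> b"
    by (simp add: u_def e_def inner_diff_right inner_add_right inner_commute)
  have mPm: "m \<bullet> (P *v m) = m \<bullet> (qrr q *v m) + m \<bullet> (qll p *v m)"
    by (simp add: P_def pivot_def matrix_vector_mult_add_rdistrib inner_add_right)
  have cross_l: "x \<bullet> (qlr q *v f) = a \<bullet> f" for f
    by (simp add: a_def dot_lmul_matrix)
  have cross_r: "z \<bullet> (f v* qlr p) = b \<bullet> f" for f
    by (metis b_def dot_lmul_matrix inner_commute)
  have cross_l': "(qlr q *v f) \<bullet> x = a \<bullet> f" and cross_r': "(f v* qlr p) \<bullet> z = b \<bullet> f" for f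
    using cross_l cross_r by (metis inner_commute)+
  note joined = quad_join_def Let_def D_def[symmetric] P_def[symmetric] e_def[symmetric] a_def[symmetric]
    b_def[symmetric] matrix_vector_mult_diff_rdistrib inner_diff_right cross_l cross_r mat_mult_vec
    matrix_vector_mult_minus
    matrix_vector_mul_assoc[symmetric]
  have ll: "x \<bullet> (qll (quad_join q p) *v x) = x \<bullet> (qll q *v x) - a \<bullet> (D *v a)"
    by (simp add: joined)
  have lr: "x \<bullet> (qlr (quad_join q p) *v z) = - (a \<bullet> (D *v b))"
    by (simp add: joined)
  have rr: "z \<bullet> (qrr (quad_join q p) *v z) = z \<bullet> (qrr p *v z) - b \<bullet> (D *v b)"
    by (simp add: joined)
  have l: "lin_l (quad_join q p) \<bullet> x = lin_l q \<bullet> x - a \<bullet> (D *v e)"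
    by (simp add: joined inner_diff_left cross_l')
  have r: "lin_r (quad_join q p) \<bullet> z = lin_r p \<bullet> z - b \<bullet> (D *v e)"
    by (simp add: joined inner_diff_left cross_r')
  have c: "join_const q p = - (e \<bullet> (D *v e)) / 2"
    by (simp add: join_const_def D_def P_def e_def)
  have "m \<bullet> (qlr p *v z) = m \<bullet> b"
    by (simp add: b_def)
  then show ?thesis
    unfolding bm P_def[symmetric] square qval_def ll lr rr l r c uDu mu mPm cross_l by argo
qed

lemma homogeneous_join: "homogeneous (quad_join q p) = quad_join (homogeneous q) (homogeneous p)"
  by (simp add: homogeneous_def quad_join_def Let_def pivot_def)

lemma pivot_homogeneous: "pivot (homogeneous q) (homogeneous p) = pivot q p"
  by (simp add: homogeneous_def pivot_def)

lemma convex_quad_pivot: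
  assumes "convex_quad q" "convex_quad p"
  shows "pos_def_matrix (pivot q p)"
proof -
  have "0 \<le> x \<bullet> (qll p *v x)" for x
  proof -
    have "0 \<le> qval (homogeneous p) x 0"
      using assms(2) by (simp add: convex_quad_def)
    then show ?thesis
      by (simp add: qval_def homogeneous_def)
  qed
  then show ?thesis
    unfolding pivot_def using assms by (intro pos_def_matrix_add) (auto simp: convex_quad_def)
qed

text \<open>
  Up to a constant, \<open>quad_join q p\<close> is the infimum of \<open>q + p\<close> over the middle state, and this infimum is
  attained. So nonnegativity passes to the join; and if the right end is nonzero, either the
  middle state is nonzero and is charged by \<open>q\<close>, or it vanishes and \<open>p\<close> charges the right end.
\<close>

lemma convex_quad_join:
  assumes q: "convex_quad q" and p: "convex_quad p"
  shows "convex_quad (quad_join q p)"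
proof -
  note pd = convex_quad_pivot[OF q p]
  let ?q = "homogeneous q" and ?p = "homogeneous p"
  have attained: "qval (homogeneous (quad_join q p)) x z
    = qval ?q x (best_middle ?q ?p x z) + qval ?p (best_middle ?q ?p x z) z" for x z
  proof -
    have "join_const ?q ?p = 0"
      by (simp add: join_const_def homogeneous_def)
    then show ?thesis
      using qval_complete_square[of ?q ?p x "best_middle ?q ?p x z" z] pd
      by (simp add: homogeneous_join pivot_homogeneous)
  qed
  have nonneg: "0 \<le> qval ?q x z" "0 \<le> qval ?p x z" for x z
    using q p by (auto simp: convex_quad_def)
  have pos: "0 < z \<bullet> (qrr (quad_join q p) *v z)" if "z \<noteq> 0" for z
  proof -
    let ?m = "best_middle ?q ?p 0 z"
    have "qval (homogeneous (quad_join q p)) 0 z = z \<bullet> (qrr (quad_join q p) *v z) / 2"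
      by (simp add: qval_def homogeneous_def)
    moreover have "0 < qval ?q 0 ?m + qval ?p ?m z"
    proof (cases "?m = 0")
      case True
      have "0 < qval ?p 0 z"
        using pos_def_matrix_pos[of "qrr p" z] p that
        by (simp add: qval_def homogeneous_def convex_quad_def)
      then show ?thesis
        using True nonneg(1)[of 0 0] by simp
    next
      case False
      have "0 < qval ?q 0 ?m"
        using pos_def_matrix_pos[of "qrr q" ?m] q False
        by (simp add: qval_def homogeneous_def convex_quad_def)
      then show ?thesis
        using nonneg(2)[of ?m z] by simp
    qed
    ultimately show ?thesis
      using attained[of 0 z] by simp
  qed
  have D: "transpose (matrix_inv (pivot q p)) = matrix_inv (pivot q p)"
    by (rule pos_def_matrix_transpose[OF pos_def_matrix_inv[OF pd]])
  have "transpose (qll (quad_join q p)) = qll (quad_join q p)" "transpose (qrr (quad_join q p)) = qrr (quad_join q p)"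
    using q p by (simp_all add: convex_quad_def quad_join_def Let_def transpose_diff matrix_transpose_mul D
        matrix_mul_assoc pos_def_matrix_transpose)
  then show ?thesis
    unfolding convex_quad_def pos_def_matrix_def
    using pos attained nonneg by (metis add_nonneg_nonneg)
qed

section \<open>Eliminating states along a balanced tree\<close>

text \<open>
  Time for one join, and also for one back substitution. The factorial is the number of
  permutations in a determinant; what matters is that the bound depends on the dimension only.
\<close>

definition join_time :: "'d::finite itself \<Rightarrow> nat" where
  "join_time _ = 3 * CARD('d) + fact CARD('d) + 11"

abbreviation zero_quad :: "('d::finite) quad" where
  "zero_quad \<equiv> \<lparr>qll = mat 0, qlr = mat 0, qrr = mat 0, lin_l = 0, lin_r = 0\<rparr>"

definition path_cost :: "(nat \<Rightarrow> 'w \<Rightarrow> ('d::finite) quad) \<Rightarrow> 'w \<Rightarrow> nat \<Rightarrow> nat \<Rightarrow> (nat \<Rightarrow> real^'d) \<Rightarrow> real" where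
  "path_cost q w l r s = (\<Sum>t\<in>{l<..r}. qval (q t w) (s (t - 1)) (s t))"

lemma path_cost_split:
  assumes "l \<le> m" "m \<le> r"
  shows "path_cost q w l r s = path_cost q w l m s + path_cost q w m r s"
proof -
  have "{l<..r} = {l<..m} \<union> {m<..r}" "{l<..m} \<inter> {m<..r} = {}"
    using assms by auto
  then show ?thesis
    unfolding path_cost_def by (simp add: sum.union_disjoint)
qed

context instances
begin

definition quad_computable :: "nat \<Rightarrow> ('w \<Rightarrow> ('d::finite) quad) \<Rightarrow> bool" where
  "quad_computable n q \<longleftrightarrow>
     mat_computable n (\<lambda>w. qll (q w)) \<and> mat_computable n (\<lambda>w. qlr (q w)) \<and>
     mat_computable n (\<lambda>w. qrr (q w)) \<and> vec_computable n (\<lambda>w. lin_l (q w)) \<and>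
     vec_computable n (\<lambda>w. lin_r (q w))"

lemma quad_computable_mono: "quad_computable n q \<Longrightarrow> n \<le> m \<Longrightarrow> quad_computable m q"
  unfolding quad_computable_def by (meson mat_computable_mono vec_computable_mono)

lemma mat_computable_zero: "mat_computable 1 (\<lambda>w. mat 0 :: real^'n^'n)"
  using computable_const[of 0] by (simp add: mat_computable_def mat_def cong: if_cong)

lemma vec_computable_zero: "vec_computable 1 (\<lambda>w. 0 :: real^'n)"
  using computable_const[of 0] by (simp add: vec_computable_def)

lemma pivot_inverse_computable:
  fixes q p :: "'w \<Rightarrow> ('d::finite) quad"
  assumes "quad_computable n q" "quad_computable n p"
    and "\<And>w. w \<in> W \<Longrightarrow> pos_def_matrix (pivot (q w) (p w))"
  shows "mat_computable (n + CARD('d) + fact CARD('d) + 6) (\<lambda>w. matrix_inv (pivot (q w) (p w)))"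
proof -
  have "mat_computable (Suc n) (\<lambda>w. pivot (q w) (p w))"
    unfolding pivot_def using assms(1,2) by (intro mat_computable_add) (auto simp: quad_computable_def)
  from mat_computable_inverse[OF this pos_def_matrix_det_nz[OF assms(3)]] show ?thesis
    by (rule mat_computable_mono) simp_all
qed

lemma best_middle_computable:
  fixes q p :: "'w \<Rightarrow> ('d::finite) quad"
  assumes q: "quad_computable n q" and p: "quad_computable n p"
    and x: "vec_computable n x" and z: "vec_computable n z"
    and pd: "\<And>w. w \<in> W \<Longrightarrow> pos_def_matrix (pivot (q w) (p w))"
  shows "vec_computable (n + join_time TYPE('d)) (\<lambda>w. best_middle (q w) (p w) (x w) (z w))"
proof -
  let ?e = "\<lambda>w. lin_r (q w) + lin_l (p w)"
    and ?a = "\<lambda>w. transpose (qlr (q w)) *v x w" and ?b = "\<lambda>w. qlr (p w) *v z w"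
  have e: "vec_computable (n + CARD('d) + 2) ?e"
    by (rule vec_computable_mono[of "Suc n"], rule vec_computable_add)
      (use q p in \<open>auto simp: quad_computable_def\<close>)
  have a: "vec_computable (n + CARD('d) + 2) ?a"
    using q x by (intro mat_vec_computable mat_computable_transpose) (auto simp: quad_computable_def)
  have b: "vec_computable (Suc (n + CARD('d) + 2)) ?b"
    by (rule vec_computable_mono[of "n + CARD('d) + 2"], rule mat_vec_computable)
      (use p z in \<open>auto simp: quad_computable_def\<close>)
  have "vec_computable (n + CARD('d) + fact CARD('d) + 6) (\<lambda>w. ?e w - ?a w - ?b w)"
    by (rule vec_computable_mono[OF vec_computable_diff[OF vec_computable_diff[OF e a] b]]) simp
  from mat_vec_computable[OF pivot_inverse_computable[OF q p pd] this]
  show ?thesis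
    unfolding best_middle_def by (rule vec_computable_mono) (simp_all add: join_time_def)
qed

lemma join_computable:
  fixes q p :: "'w \<Rightarrow> ('d::finite) quad"
  assumes q: "quad_computable n q" and p: "quad_computable n p"
    and pd: "\<And>w. w \<in> W \<Longrightarrow> pos_def_matrix (pivot (q w) (p w))"
  shows "quad_computable (n + join_time TYPE('d)) (\<lambda>w. quad_join (q w) (p w))"
proof -
  let ?D = "\<lambda>w. matrix_inv (pivot (q w) (p w))" and ?e = "\<lambda>w. lin_r (q w) + lin_l (p w)"
  let ?k = "n + CARD('d) + fact CARD('d) + 6"
  let ?k' = "?k + CARD('d) + 2 + CARD('d) + 2"
  have D: "mat_computable ?k ?D"
    by (rule pivot_inverse_computable[OF q p pd])
  have mats: "mat_computable ?k (\<lambda>w. qlr (q w))" "mat_computable ?k (\<lambda>w. qlr (p w))"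
    by (rule mat_computable_mono[of n]; use q p in \<open>simp add: quad_computable_def\<close>)+
  have triple: "mat_computable ?k' (\<lambda>w. A w ** ?D w ** B w)"
    if "mat_computable ?k A" "mat_computable ?k B" for A B :: "'w \<Rightarrow> real^'d^'d"
    using that D by (intro mat_mat_computable) (auto intro: mat_computable_mono)
  have e: "vec_computable ?k ?e"
    by (rule vec_computable_mono[of "Suc n"], rule vec_computable_add)
      (use q p in \<open>auto simp: quad_computable_def\<close>)
  have lin: "vec_computable ?k' (\<lambda>w. A w *v (?D w *v ?e w))"
    if "mat_computable ?k A" for A :: "'w \<Rightarrow> real^'d^'d"
    using that D e by (intro mat_vec_computable) (auto intro: mat_computable_mono)
  have old: "mat_computable ?k' (\<lambda>w. qll (q w))" "mat_computable ?k' (\<lambda>w. qrr (p w))"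
    by (rule mat_computable_mono[of n]; use q p in \<open>simp add: quad_computable_def\<close>)+
  have old': "vec_computable ?k' (\<lambda>w. lin_l (q w))" "vec_computable ?k' (\<lambda>w. lin_r (p w))"
    by (rule vec_computable_mono[of n]; use q p in \<open>simp add: quad_computable_def\<close>)+
  have zero: "mat_computable ?k' (\<lambda>w. mat 0 :: real^'d^'d)"
    by (rule mat_computable_mono[OF mat_computable_zero]) simp
  have "quad_computable (Suc ?k') (\<lambda>w. quad_join (q w) (p w))"
    unfolding quad_computable_def quad_join_def Let_def quad.simps
    by (intro conjI mat_computable_diff vec_computable_diff triple lin mats old old' zero
        mat_computable_transpose)
  then show ?thesis
    by (rule quad_computable_mono) (simp add: join_time_def)
qed

text \<open>
  After \<open>up\<close> steps a segment is summarized by one quadratic \<open>Q\<close> in its two end states: the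
  minimum of the cost over the states in between, up to a constant. Given the end states,
  \<open>down\<close> further steps find the unique path \<open>\<sigma>\<close> that attains it.
\<close>

definition eliminates ::
  "(nat \<Rightarrow> 'w \<Rightarrow> ('d::finite) quad) \<Rightarrow> nat \<Rightarrow> nat \<Rightarrow> nat \<Rightarrow> nat \<Rightarrow> ('w \<Rightarrow> 'd quad) \<Rightarrow> ('w \<Rightarrow> real) \<Rightarrow> bool" where
  "eliminates q up down l r Q k \<longleftrightarrow>
    quad_computable up Q \<and>
    (\<forall>w\<in>W. convex_quad (Q w) \<and> (\<forall>s. qval (Q w) (s l) (s r) + k w \<le> path_cost q w l r s)) \<and>
    (\<forall>d x z. up \<le> d \<longrightarrow> vec_computable d x \<longrightarrow> vec_computable d z \<longrightarrow>
      (\<exists>\<sigma>. \<sigma> l = x \<and> \<sigma> r = z \<and> (\<forall>t\<in>{l..r}. vec_computable (d + down) (\<sigma> t)) \<and>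
        (\<forall>w\<in>W. \<forall>s. s l = x w \<and> s r = z w \<longrightarrow>
          (path_cost q w l r s = qval (Q w) (s l) (s r) + k w \<longleftrightarrow>
           (\<forall>t\<in>{l..r}. s t = \<sigma> t w)))))"

definition eliminable ::
  "(nat \<Rightarrow> 'w \<Rightarrow> ('d::finite) quad) \<Rightarrow> nat \<Rightarrow> nat \<Rightarrow> nat \<Rightarrow> nat \<Rightarrow> bool" where
  "eliminable q up down l r \<longleftrightarrow> (\<exists>Q k. eliminates q up down l r Q k)"

lemma eliminatesD:
  assumes "eliminates q up down l r Q k"
  shows "quad_computable up Q"
    and "w \<in> W \<Longrightarrow> convex_quad (Q w)"
    and "w \<in> W \<Longrightarrow> qval (Q w) (s l) (s r) + k w \<le> path_cost q w l r s"
  using assms unfolding eliminates_def by (simp, simp, simp)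

lemma eliminates_path:
  assumes "eliminates q up down l r Q k" "up \<le> d" "vec_computable d x" "vec_computable d z"
  obtains \<sigma> where "\<sigma> l = x" "\<sigma> r = z" "\<And>t. t \<in> {l..r} \<Longrightarrow> vec_computable (d + down) (\<sigma> t)"
    "\<And>w s. w \<in> W \<Longrightarrow> s l = x w \<Longrightarrow> s r = z w \<Longrightarrow>
      path_cost q w l r s = qval (Q w) (s l) (s r) + k w \<longleftrightarrow> (\<forall>t\<in>{l..r}. s t = \<sigma> t w)"
proof -
  from assms(1)[unfolded eliminates_def, THEN conjunct2, THEN conjunct2, rule_format, OF assms(2-4)]
  show thesis
    by (elim exE conjE) (rule that, assumption, assumption, simp, simp)
qed

text \<open>A segment of one step has no state in between.\<close>

lemma eliminable_single:
  assumes "quad_computable up (q (Suc l))" and "\<And>w. w \<in> W \<Longrightarrow> convex_quad (q (Suc l) w)"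
  shows "eliminable q up down l (Suc l)"
proof -
  have set: "{l<..Suc l} = {Suc l}" "{l..Suc l} = {l, Suc l}"
    by auto
  show ?thesis
    unfolding eliminable_def eliminates_def path_cost_def set
    by (rule exI[of _ "q (Suc l)"], rule exI[of _ "\<lambda>_. 0"], intro conjI allI impI)
      (use assms in \<open>auto intro: vec_computable_mono intro!: exI[of _ "(\<lambda>_. _)(l := _)"]\<close>)
qed

text \<open>
  The cost of the long segment exceeds the joined quadratic by three nonnegative amounts: the slack
  of either half and the completed square in the middle state. A path is optimal if and only if all
  three vanish. So the middle state must be \<open>best_middle\<close> of the outer ones, and then both halves are
  problems with known end states that are solved simultaneously.
\<close>

lemma eliminable_join:
  fixes q :: "nat \<Rightarrow> 'w \<Rightarrow> ('d::finite) quad"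
  assumes "l < m" "m < r"
    and left: "eliminable q up down l m" and right: "eliminable q up down m r"
  defines "\<kappa> \<equiv> join_time TYPE('d)"
  shows "eliminable q (up + \<kappa>) (\<kappa> + down) l r"
proof -
  obtain Q1 k1 where E1: "eliminates q up down l m Q1 k1"
    using left unfolding eliminable_def by blast
  obtain Q2 k2 where E2: "eliminates q up down m r Q2 k2"
    using right unfolding eliminable_def by blast
  note Q1 = eliminatesD[OF E1] and Q2 = eliminatesD[OF E2]
  define Q where "Q = (\<lambda>w. quad_join (Q1 w) (Q2 w))"
  define k where "k = (\<lambda>w. join_const (Q1 w) (Q2 w) + k1 w + k2 w)"
  define best where "best = (\<lambda>w. best_middle (Q1 w) (Q2 w))"
  have pd: "pos_def_matrix (pivot (Q1 w) (Q2 w))" if "w \<in> W" for w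
    using convex_quad_pivot Q1(2) Q2(2) that by blast
  have split: "path_cost q w l r s = path_cost q w l m s + path_cost q w m r s" for w s
    using path_cost_split[of l m r] assms(1,2) by simp
  define gap where "gap = (\<lambda>w s. (s m - best w (s l) (s r)) \<bullet>
    (pivot (Q1 w) (Q2 w) *v (s m - best w (s l) (s r))) / 2)"
  have square: "qval (Q1 w) (s l) (s m) + k1 w + (qval (Q2 w) (s m) (s r) + k2 w)
      = qval (Q w) (s l) (s r) + k w + gap w s" if "w \<in> W" for w s
    using qval_complete_square[OF pd[OF that], of "s l" "s m" "s r"]
    by (simp add: Q_def k_def gap_def best_def)
  have gap_nonneg: "0 \<le> gap w s" if "w \<in> W" for w s
    using pos_def_matrix_nonneg[OF pd[OF that]] by (simp add: gap_def)
  have gap_0: "gap w s = 0 \<longleftrightarrow> s m = best w (s l) (s r)" if "w \<in> W" for w s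
    using pos_def_matrix_eq_0_iff[OF pd[OF that]] by (simp add: gap_def)
  show ?thesis
    unfolding eliminable_def eliminates_def
  proof (rule exI[of _ Q], rule exI[of _ k], intro conjI ballI allI impI)
    show "quad_computable (up + \<kappa>) Q"
      unfolding Q_def \<kappa>_def using join_computable Q1(1) Q2(1) pd by blast
    fix w assume w: "w \<in> W"
    show "convex_quad (Q w)"
      unfolding Q_def using convex_quad_join Q1(2) Q2(2) w by blast
    show "qval (Q w) (s l) (s r) + k w \<le> path_cost q w l r s" for s
      using square[OF w, of s] gap_nonneg[OF w, of s] Q1(3)[OF w, of s] Q2(3)[OF w, of s]
      unfolding split by linarith
  next
    fix d and x z :: "'w \<Rightarrow> real^'d"
    assume d: "up + \<kappa> \<le> d" and xz: "vec_computable d x" "vec_computable d z"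
    define y where "y = (\<lambda>w. best w (x w) (z w))"
    have "quad_computable d Q1" "quad_computable d Q2"
      using Q1(1) Q2(1) d quad_computable_mono by (meson add_leD1)+
    then have y: "vec_computable (d + \<kappa>) y"
      unfolding y_def best_def \<kappa>_def using xz pd by (intro best_middle_computable)
    have x': "vec_computable (d + \<kappa>) x" and z': "vec_computable (d + \<kappa>) z"
      using xz by (auto intro: vec_computable_mono)
    have up: "up \<le> d + \<kappa>"
      using d by simp
    obtain \<sigma>1 where s1: "\<sigma>1 l = x" "\<sigma>1 m = y" "\<And>t. t \<in> {l..m} \<Longrightarrow> vec_computable (d + \<kappa> + down) (\<sigma>1 t)"
      "\<And>w s. w \<in> W \<Longrightarrow> s l = x w \<Longrightarrow> s m = y w \<Longrightarrow>
        (path_cost q w l m s = qval (Q1 w) (s l) (s m) + k1 w \<longleftrightarrow> (\<forall>t\<in>{l..m}. s t = \<sigma>1 t w))"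
      by (rule eliminates_path[OF E1 up x' y]) blast
    obtain \<sigma>2 where s2: "\<sigma>2 m = y" "\<sigma>2 r = z" "\<And>t. t \<in> {m..r} \<Longrightarrow> vec_computable (d + \<kappa> + down) (\<sigma>2 t)"
      "\<And>w s. w \<in> W \<Longrightarrow> s m = y w \<Longrightarrow> s r = z w \<Longrightarrow>
        (path_cost q w m r s = qval (Q2 w) (s m) (s r) + k2 w \<longleftrightarrow> (\<forall>t\<in>{m..r}. s t = \<sigma>2 t w))"
      by (rule eliminates_path[OF E2 up y z']) blast
    define \<sigma> where "\<sigma> = (\<lambda>t. if t \<le> m then \<sigma>1 t else \<sigma>2 t)"
    have all: "(\<forall>t\<in>{l..r}. s t = \<sigma> t w) \<longleftrightarrow> (\<forall>t\<in>{l..m}. s t = \<sigma>1 t w) \<and> (\<forall>t\<in>{m..r}. s t = \<sigma>2 t w)"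
      for s w
    proof -
      have "\<sigma> t = \<sigma>2 t" if "t \<in> {m..r}" for t
        using that s1(2) s2(1) by (auto simp: \<sigma>_def)
      moreover have "\<sigma> t = \<sigma>1 t" if "t \<in> {l..m}" for t
        using that by (auto simp: \<sigma>_def)
      moreover have "{l..r} = {l..m} \<union> {m..r}"
        using assms(1,2) by auto
      ultimately show ?thesis
        by (simp add: ball_Un)
    qed
    have "path_cost q w l r s = qval (Q w) (s l) (s r) + k w \<longleftrightarrow> (\<forall>t\<in>{l..r}. s t = \<sigma> t w)"
      if w: "w \<in> W" and s: "s l = x w" "s r = z w" for w s
    proof -
      have "path_cost q w l r s = qval (Q w) (s l) (s r) + k w \<longleftrightarrow>
        gap w s = 0 \<and> path_cost q w l m s = qval (Q1 w) (s l) (s m) + k1 w \<and>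
        path_cost q w m r s = qval (Q2 w) (s m) (s r) + k2 w"
        using square[OF w, of s] gap_nonneg[OF w, of s] Q1(3)[OF w, of s] Q2(3)[OF w, of s]
        unfolding split by auto
      also have "\<dots> \<longleftrightarrow> s m = y w \<and> (\<forall>t\<in>{l..m}. s t = \<sigma>1 t w) \<and> (\<forall>t\<in>{m..r}. s t = \<sigma>2 t w)"
        using gap_0[OF w, of s] s1(4)[OF w, of s] s2(4)[OF w, of s] s unfolding y_def by metis
      also have "\<dots> \<longleftrightarrow> (\<forall>t\<in>{l..r}. s t = \<sigma> t w)"
        unfolding all using s1(2) assms(1) by (metis atLeastAtMost_iff less_imp_le order_refl)
      finally show ?thesis .
    qed
    moreover have "\<sigma> l = x" "\<sigma> r = z"
      using s1(1) s2(2) assms(1,2) by (auto simp: \<sigma>_def)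
    moreover have "\<forall>t\<in>{l..r}. vec_computable (d + (\<kappa> + down)) (\<sigma> t)"
      using s1(3) s2(3) by (auto simp: \<sigma>_def add.assoc)
    ultimately show "\<exists>\<sigma>. \<sigma> l = x \<and> \<sigma> r = z \<and> (\<forall>t\<in>{l..r}. vec_computable (d + (\<kappa> + down)) (\<sigma> t)) \<and>
          (\<forall>w\<in>W. \<forall>s. s l = x w \<and> s r = z w \<longrightarrow>
            (path_cost q w l r s = qval (Q w) (s l) (s r) + k w \<longleftrightarrow>
             (\<forall>t\<in>{l..r}. s t = \<sigma> t w)))"
      by blast
  qed
qed

lemma eliminable_segment:
  fixes q :: "nat \<Rightarrow> 'w \<Rightarrow> ('d::finite) quad"
  assumes q: "\<And>t. t \<in> {1..T} \<Longrightarrow> quad_computable c (q t)"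
    and convex: "\<And>t w. t \<in> {1..T} \<Longrightarrow> w \<in> W \<Longrightarrow> convex_quad (q t w)"
  shows "l < r \<Longrightarrow> r \<le> T \<Longrightarrow> r - l \<le> 2 ^ n \<Longrightarrow>
    eliminable q (c + n * join_time TYPE('d)) (n * join_time TYPE('d)) l r"
proof (induction n arbitrary: l r)
  case 0
  then have "r = Suc l"
    by simp
  then show ?case
    unfolding \<open>r = Suc l\<close> using q convex 0 by (intro eliminable_single) auto
next
  case (Suc n)
  show ?case
  proof (cases "r = Suc l")
    case True
    have "quad_computable (c + Suc n * join_time TYPE('d)) (q r)"
      by (rule quad_computable_mono[OF q]) (use Suc.prems in auto)
    then show ?thesis
      unfolding True using convex Suc.prems True by (intro eliminable_single) auto
  next
    case False
    \<comment> \<open>Both halves are nonempty since the segment has at least two steps.\<close>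
    define m where "m = l + (r - l) div 2"
    have m: "l < m" "m < r" "m - l \<le> 2 ^ n" "r - m \<le> 2 ^ n"
      using False Suc.prems by (auto simp: m_def)
    from eliminable_join[OF m(1,2) Suc.IH Suc.IH] m Suc.prems
    show ?thesis
      by (simp add: algebra_simps)
  qed
qed

text \<open>
  The last state is free, which is the same as joining the whole path with a zero cost on its
  right.
\<close>

lemma path_minimizer_computable:
  fixes q :: "nat \<Rightarrow> 'w \<Rightarrow> ('d::finite) quad" and x0 :: "'w \<Rightarrow> real^'d"
  assumes q: "\<And>t. t \<in> {1..T} \<Longrightarrow> quad_computable c (q t)"
    and convex: "\<And>t w. t \<in> {1..T} \<Longrightarrow> w \<in> W \<Longrightarrow> convex_quad (q t w)"
    and x0: "vec_computable c x0" and T: "1 \<le> T" "T \<le> 2 ^ n" and "1 \<le> c"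
  obtains \<sigma> where "\<And>t. t \<in> {1..T} \<Longrightarrow> vec_computable (c + (2 * n + 1) * join_time TYPE('d)) (\<sigma> t)"
    "\<And>w s. w \<in> W \<Longrightarrow> s 0 = x0 w \<Longrightarrow>
      (\<forall>s'. s' 0 = x0 w \<longrightarrow> path_cost q w 0 T s \<le> path_cost q w 0 T s') \<longleftrightarrow>
      (\<forall>t\<in>{1..T}. s t = \<sigma> t w)"
proof -
  let ?\<kappa> = "join_time TYPE('d)"
  have "eliminable q (c + n * ?\<kappa>) (n * ?\<kappa>) 0 T"
    by (rule eliminable_segment[where T = T]) (use assms in auto)
  then obtain Q k where E: "eliminates q (c + n * ?\<kappa>) (n * ?\<kappa>) 0 T Q k"
    unfolding eliminable_def by blast
  note Q = eliminatesD[OF E]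
  define best where "best = (\<lambda>w. best_middle (Q w) zero_quad (x0 w) 0)"
  have "pivot (Q w) zero_quad = qrr (Q w)" for w
    by (simp add: pivot_def vec_eq_iff mat_def)
  then have pd: "pos_def_matrix (pivot (Q w) zero_quad)" if "w \<in> W" for w
    using Q(2)[OF that] by (simp add: convex_quad_def)
  have zero: "quad_computable (c + n * ?\<kappa>) (\<lambda>w. zero_quad)"
    by (rule quad_computable_mono[of 1])
      (use \<open>1 \<le> c\<close> in \<open>auto simp: quad_computable_def mat_computable_zero[simplified] vec_computable_zero[simplified]\<close>)
  have x0': "vec_computable (c + n * ?\<kappa>) x0"
    by (rule vec_computable_mono[OF x0]) simp
  have zero': "vec_computable (c + n * ?\<kappa>) (\<lambda>w. 0 :: real^'d)"
    by (rule vec_computable_mono[OF vec_computable_zero]) (use \<open>1 \<le> c\<close> in simp)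
  have best: "vec_computable (c + n * ?\<kappa> + ?\<kappa>) best"
    unfolding best_def by (rule best_middle_computable[OF Q(1) zero x0' zero' pd])
  have "vec_computable (c + n * ?\<kappa> + ?\<kappa>) x0"
    by (rule vec_computable_mono[OF x0]) simp
  then obtain \<sigma> where \<sigma>: "\<sigma> 0 = x0" "\<sigma> T = best"
    "\<And>t. t \<in> {0..T} \<Longrightarrow> vec_computable (c + n * ?\<kappa> + ?\<kappa> + n * ?\<kappa>) (\<sigma> t)"
    "\<And>w s. w \<in> W \<Longrightarrow> s 0 = x0 w \<Longrightarrow> s T = best w \<Longrightarrow>
      path_cost q w 0 T s = qval (Q w) (s 0) (s T) + k w \<longleftrightarrow> (\<forall>t\<in>{0..T}. s t = \<sigma> t w)"
    by (rule eliminates_path[OF E le_add1 _ best]) blast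
  have iff: "(\<forall>s'. s' 0 = x0 w \<longrightarrow> path_cost q w 0 T s \<le> path_cost q w 0 T s') \<longleftrightarrow>
      (\<forall>t\<in>{1..T}. s t = \<sigma> t w)" if w: "w \<in> W" and s0: "s 0 = x0 w" for w s
  proof -
    define v where "v = qval (quad_join (Q w) zero_quad) (x0 w) 0 + join_const (Q w) zero_quad + k w"
    define gap where "gap = (\<lambda>z. (z - best w) \<bullet> (pivot (Q w) zero_quad *v (z - best w)) / 2)"
    have gap: "0 \<le> gap z" "gap z = 0 \<longleftrightarrow> z = best w" for z
      using pos_def_matrix_nonneg[OF pd[OF w]] pos_def_matrix_eq_0_iff[OF pd[OF w]]
      by (auto simp: gap_def)
    have "qval zero_quad z 0 = 0" for z :: "real^'d"
      by (simp add: qval_def mat_mult_vec)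
    then have square: "qval (Q w) (x0 w) z + k w = v + gap z" for z
      using qval_complete_square[OF pd[OF w], of "x0 w" z 0] by (simp add: v_def gap_def best_def)
    have lower: "v \<le> path_cost q w 0 T s'" if "s' 0 = x0 w" for s'
      using Q(3)[OF w, of s'] square[of "s' T"] gap(1)[of "s' T"] that by simp
    have optimal: "path_cost q w 0 T s' = v \<longleftrightarrow> (\<forall>t\<in>{0..T}. s' t = \<sigma> t w)" if "s' 0 = x0 w" for s'
    proof -
      have "path_cost q w 0 T s' = v \<longleftrightarrow>
        s' T = best w \<and> path_cost q w 0 T s' = qval (Q w) (s' 0) (s' T) + k w"
        using Q(3)[OF w, of s'] square[of "s' T"] gap(1)[of "s' T"] gap(2)[of "s' T"] that by auto
      also have "\<dots> \<longleftrightarrow> s' T = best w \<and> (\<forall>t\<in>{0..T}. s' t = \<sigma> t w)"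
        using \<sigma>(4)[OF w, of s'] that by blast
      also have "\<dots> \<longleftrightarrow> (\<forall>t\<in>{0..T}. s' t = \<sigma> t w)"
        using \<sigma>(2) by auto
      finally show ?thesis .
    qed
    have "path_cost q w 0 T (\<lambda>t. \<sigma> t w) = v"
      using optimal[of "\<lambda>t. \<sigma> t w"] \<sigma>(1) by simp
    then have "(\<forall>s'. s' 0 = x0 w \<longrightarrow> path_cost q w 0 T s \<le> path_cost q w 0 T s') \<longleftrightarrow>
      path_cost q w 0 T s = v"
      using lower s0 \<sigma>(1) by (metis order_antisym)
    also have "\<dots> \<longleftrightarrow> (\<forall>t\<in>{0..T}. s t = \<sigma> t w)"
      using optimal[of s] s0 by blast
    also have "{0..T} = insert 0 {1..T}"
      by auto
    finally show ?thesis
      using s0 \<sigma>(1) by simp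
  qed
  have "c + n * ?\<kappa> + ?\<kappa> + n * ?\<kappa> = c + (2 * n + 1) * ?\<kappa>"
    by (simp add: algebra_simps)
  then have time: "vec_computable (c + (2 * n + 1) * ?\<kappa>) (\<sigma> t)" if "t \<in> {1..T}" for t
    using \<sigma>(3)[of t] that by (simp only:) simp
  show thesis
  proof (rule that)
    show "vec_computable (c + (2 * n + 1) * ?\<kappa>) (\<sigma> t)" if "t \<in> {1..T}" for t
      by (rule time[OF that])
    show "(\<forall>s'. s' 0 = x0 w \<longrightarrow> path_cost q w 0 T s \<le> path_cost q w 0 T s') \<longleftrightarrow>
      (\<forall>t\<in>{1..T}. s t = \<sigma> t w)" if "w \<in> W" "s 0 = x0 w" for w s
      by (rule iff) (rule that)+
  qed
qed

end

section \<open>MAP estimation as least squares\<close>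

lemma continuous_on_matrix_vector_mult [continuous_intros]:
  fixes A :: "real^'n^'k"
  shows "continuous_on S f \<Longrightarrow> continuous_on S (\<lambda>x. A *v f x)"
  by (rule bounded_linear.continuous_on[OF matrix_vector_mul_bounded_linear])

definition mvn_normalizer :: "real^'n^'n \<Rightarrow> real" where
  "mvn_normalizer S = sqrt ((2 * pi) ^ CARD('n) * det S)"

lemma mvn_normalizer_pos: "pos_def_matrix S \<Longrightarrow> 0 < mvn_normalizer S"
  by (simp add: mvn_normalizer_def pos_def_matrix_det_pos)

lemma mvn_density_pos: "pos_def_matrix S \<Longrightarrow> 0 < mvn_density m S x"
  using mvn_normalizer_pos[of S] by (simp add: mvn_density_def mvn_normalizer_def)

lemma mvn_density_le: "pos_def_matrix S \<Longrightarrow> mvn_density m S x \<le> 1 / mvn_normalizer S"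
  unfolding mvn_density_def mvn_normalizer_def[symmetric]
  by (intro divide_right_mono)
    (auto simp: pos_def_matrix_nonneg[OF pos_def_matrix_inv] less_imp_le[OF mvn_normalizer_pos])

lemma measurable_mvn_density [measurable (raw)]:
  fixes f g :: "'a \<Rightarrow> real^'n"
  assumes "f \<in> borel_measurable N" "g \<in> borel_measurable N"
  shows "(\<lambda>x. mvn_density (f x) S (g x)) \<in> borel_measurable N"
  by (rule borel_measurable_continuous_Pair[OF assms])
    (unfold mvn_density_def divide_inverse, intro continuous_intros)

lemma nn_integral_lborel_shift:
  fixes f :: "'a::euclidean_space \<Rightarrow> ennreal"
  assumes "f \<in> borel_measurable borel"
  shows "(\<integral>\<^sup>+x. f (x - m) \<partial>lborel) = (\<integral>\<^sup>+x. f x \<partial>lborel)"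
proof -
  have "(\<integral>\<^sup>+x. f x \<partial>lborel) = (\<integral>\<^sup>+x. f x \<partial>distr lborel borel ((+) (- m)))"
    by (simp only: lborel_distr_plus)
  also have "\<dots> = (\<integral>\<^sup>+x. f (- m + x) \<partial>lborel)"
    using assms by (subst nn_integral_distr) auto
  finally show ?thesis
    by simp
qed

lemma nn_integral_exp_neg_square_finite:
  fixes c :: real
  assumes "0 < c"
  shows "(\<integral>\<^sup>+x. ennreal (exp (- c * x\<^sup>2)) \<partial>lborel) < \<infinity>"
proof -
  define \<sigma> where "\<sigma> = 1 / sqrt (2 * c)"
  have \<sigma>: "0 < \<sigma>" "2 * \<sigma>\<^sup>2 = 1 / c"
    using assms by (auto simp: \<sigma>_def power_divide)
  have "integrable lborel (normal_density 0 \<sigma>)"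
    using normal_moment_even[OF \<sigma>(1), of 0 0] by (auto simp: has_bochner_integral_iff)
  then have "integrable lborel (\<lambda>x. sqrt (2 * pi * \<sigma>\<^sup>2) * normal_density 0 \<sigma> x)"
    by simp
  also have "(\<lambda>x. sqrt (2 * pi * \<sigma>\<^sup>2) * normal_density 0 \<sigma> x) = (\<lambda>x. exp (- c * x\<^sup>2))"
    using \<sigma> by (auto simp: normal_density_def fun_eq_iff)
  finally show ?thesis
    by (simp add: integrable_iff_bounded)
qed

text \<open>
  By coercivity the density is dominated by an isotropic Gaussian, which is a product over the
  coordinates.
\<close>

lemma nn_integral_mvn_density_finite:
  fixes S :: "real^'n^'n"
  assumes S: "pos_def_matrix S"
  shows "(\<integral>\<^sup>+x. ennreal (mvn_density 0 S x) \<partial>lborel) < \<infinity>"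
proof -
  obtain c where c: "0 < c" "\<And>x. c * (norm x)\<^sup>2 \<le> x \<bullet> (matrix_inv S *v x)"
    using pos_def_matrix_coercive[OF pos_def_matrix_inv[OF S]] by blast
  let ?g = "\<lambda>x. \<Prod>b\<in>(Basis :: (real^'n) set). ennreal (exp (- (c / 2) * (x \<bullet> b)\<^sup>2))"
  have "mvn_density 0 S x \<le> 1 / mvn_normalizer S * exp (- (c / 2) * (norm x)\<^sup>2)" for x
    unfolding mvn_density_def mvn_normalizer_def[symmetric]
    using c(2)[of x] mvn_normalizer_pos[OF S] by (simp add: field_simps)
  moreover have "ennreal (exp (- (c / 2) * (norm x)\<^sup>2)) = ?g x" for x :: "real^'n"
  proof -
    have "(norm x)\<^sup>2 = (\<Sum>b\<in>Basis. (x \<bullet> b)\<^sup>2)"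
      by (subst power2_norm_eq_inner, subst euclidean_inner) (simp add: power2_eq_square)
    then show ?thesis
      by (simp add: prod_ennreal sum_distrib_left exp_sum[symmetric])
  qed
  ultimately have le: "ennreal (mvn_density 0 S x) \<le> ennreal (1 / mvn_normalizer S) * ?g x" for x
    using mvn_normalizer_pos[OF S]
    by (metis ennreal_leI ennreal_mult' less_imp_le zero_less_divide_1_iff)
  have "(\<integral>\<^sup>+x. ennreal (mvn_density 0 S x) \<partial>lborel)
    \<le> (\<integral>\<^sup>+x. ennreal (1 / mvn_normalizer S) * ?g x \<partial>lborel)"
    by (rule nn_integral_mono) (rule le)
  also have "\<dots> = ennreal (1 / mvn_normalizer S) * (\<integral>\<^sup>+x. ?g x \<partial>lborel)"
    by (rule nn_integral_cmult) simp
  also have "(\<integral>\<^sup>+x. ?g x \<partial>lborel)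
    = (\<Prod>b\<in>(Basis :: (real^'n) set). \<integral>\<^sup>+x. ennreal (exp (- (c / 2) * x\<^sup>2)) \<partial>lborel)"
    by (rule nn_integral_lborel_prod) auto
  also have "ennreal (1 / mvn_normalizer S) * \<dots> < \<infinity>"
    using nn_integral_exp_neg_square_finite[of "c / 2"] c(1)
    by (simp add: ennreal_mult_less_top power_less_top_ennreal)
  finally show ?thesis .
qed

definition predicted_state :: "('d::finite, 'm::finite) lgssm \<Rightarrow> (nat \<Rightarrow> real^'d) \<Rightarrow> nat \<Rightarrow> real^'d" where
  "predicted_state M s t = trans M t *v (s(0 := init_state M)) (t - 1) + trans_offset M t"

lemma measurable_predicted_state [measurable (raw)]:
  assumes "t \<in> {1..T}"
  shows "(\<lambda>s. predicted_state M s t) \<in> borel_measurable (\<Pi>\<^sub>M t\<in>{1..T}. lborel)"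
proof -
  have "(\<lambda>s. (s(0 := init_state M)) (t - 1)) \<in> borel_measurable (\<Pi>\<^sub>M t\<in>{1..T}. lborel)"
  proof (cases "t = 1")
    case False
    then have "t - 1 \<in> {1..T}" "t - 1 \<noteq> 0"
      using assms by auto
    then show ?thesis
      using measurable_component_singleton[of "t - 1" "{1..T}" "\<lambda>_. lborel"] by simp
  qed simp
  then show ?thesis
    unfolding predicted_state_def
    by (rule measurable_compose[OF _ borel_measurable_continuous_onI]) (intro continuous_intros)
qed

text \<open>
  The offset of a Gaussian transition density does not affect its integral, so the states can be
  integrated out one after the other, last one first.
\<close>

lemma nn_integral_transition_densities:
  fixes M :: "('d::finite, 'm::finite) lgssm"
  shows "(\<integral>\<^sup>+s. (\<Prod>t=1..T. ennreal (mvn_density (predicted_state M s t) (trans_cov M t) (s t)))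
      \<partial>(\<Pi>\<^sub>M t\<in>{1..T}. lborel))
    = (\<Prod>t=1..T. \<integral>\<^sup>+x. ennreal (mvn_density 0 (trans_cov M t) x) \<partial>lborel)"
proof (induction T)
  case 0
  show ?case
    by (simp add: PiM_empty nn_integral_count_space_finite)
next
  case (Suc T)
  interpret product_sigma_finite "\<lambda>_. lborel" ..
  let ?g = "\<lambda>t s. ennreal (mvn_density (predicted_state M s t) (trans_cov M t) (s t))"
  let ?I = "\<lambda>t. \<integral>\<^sup>+x. ennreal (mvn_density 0 (trans_cov M t) x) \<partial>lborel"
  have set: "{1..Suc T} = insert (Suc T) {1..T}"
    by auto
  have meas: "?g t \<in> borel_measurable (\<Pi>\<^sub>M t\<in>{1..T}. lborel)" if "t \<in> {1..T}" for t T
  proof -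
    have "(\<lambda>s. s t) \<in> borel_measurable (\<Pi>\<^sub>M t\<in>{1..T}. lborel :: (real^'d) measure)"
      using measurable_component_singleton[of t "{1..T}" "\<lambda>_. lborel"] that by simp
    then show ?thesis
      using measurable_predicted_state[OF that] by measurable
  qed
  have prev: "?g t (s(Suc T := x)) = ?g t s" if "t \<in> {1..T}" for t s x
  proof -
    have "t - 1 \<noteq> Suc T" "t \<noteq> Suc T"
      using that by auto
    then show ?thesis
      by (simp add: predicted_state_def fun_upd_twist)
  qed
  have upd: "predicted_state M (s(Suc T := x)) (Suc T) = predicted_state M s (Suc T)" for s x
    by (simp add: predicted_state_def)
  have last: "(\<integral>\<^sup>+x. ?g (Suc T) (s(Suc T := x)) \<partial>lborel) = ?I (Suc T)" for s
  proof -
    let ?m = "predicted_state M s (Suc T)"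
    have "?g (Suc T) (s(Suc T := x)) = ennreal (mvn_density 0 (trans_cov M (Suc T)) (x - ?m))" for x
      unfolding upd by (simp add: mvn_density_def)
    then show ?thesis
      using nn_integral_lborel_shift[of "\<lambda>x. ennreal (mvn_density 0 (trans_cov M (Suc T)) x)" ?m]
      by simp
  qed
  have split: "(\<Prod>t=1..Suc T. ?g t (s(Suc T := x))) = (\<Prod>t=1..T. ?g t s) * ?g (Suc T) (s(Suc T := x))"
    for s x
  proof -
    have same: "(\<Prod>t=1..T. ?g t (s(Suc T := x))) = (\<Prod>t=1..T. ?g t s)"
      by (rule prod.cong[OF refl prev])
    have step: "(\<Prod>t=1..Suc T. ?g t (s(Suc T := x)))
        = ?g (Suc T) (s(Suc T := x)) * (\<Prod>t=1..T. ?g t (s(Suc T := x)))"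
      by (rule prod.nat_ivl_Suc') simp
    show ?thesis
      unfolding step same by (rule mult.commute)
  qed
  have prod_meas: "(\<lambda>s. \<Prod>t=1..T. ?g t s) \<in> borel_measurable (\<Pi>\<^sub>M t\<in>{1..T}. lborel)" for T
    by (intro borel_measurable_prod_ennreal meas)
  from this[of "Suc T"] have "(\<integral>\<^sup>+s. (\<Prod>t=1..Suc T. ?g t s) \<partial>(\<Pi>\<^sub>M t\<in>{1..Suc T}. lborel))
    = (\<integral>\<^sup>+s. (\<integral>\<^sup>+x. (\<Prod>t=1..Suc T. ?g t (s(Suc T := x))) \<partial>lborel) \<partial>(\<Pi>\<^sub>M t\<in>{1..T}. lborel))"
    unfolding set by (intro product_nn_integral_insert) auto
  also have "\<dots> = (\<integral>\<^sup>+s. (\<integral>\<^sup>+x. (\<Prod>t=1..T. ?g t s) * ?g (Suc T) (s(Suc T := x)) \<partial>lborel)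
      \<partial>(\<Pi>\<^sub>M t\<in>{1..T}. lborel))"
    by (simp only: split)
  also have "\<dots> = (\<integral>\<^sup>+s. (\<Prod>t=1..T. ?g t s) * ?I (Suc T) \<partial>(\<Pi>\<^sub>M t\<in>{1..T}. lborel))"
  proof (rule nn_integral_cong)
    fix s :: "nat \<Rightarrow> real^'d"
    have "(\<lambda>x. ?g (Suc T) (s(Suc T := x))) \<in> borel_measurable lborel"
      unfolding upd fun_upd_same by measurable
    from nn_integral_cmult[OF this]
    show "(\<integral>\<^sup>+x. (\<Prod>t=1..T. ?g t s) * ?g (Suc T) (s(Suc T := x)) \<partial>lborel) = (\<Prod>t=1..T. ?g t s) * ?I (Suc T)"
      unfolding last .
  qed
  also have "\<dots> = (\<integral>\<^sup>+s. (\<Prod>t=1..T. ?g t s) \<partial>(\<Pi>\<^sub>M t\<in>{1..T}. lborel)) * ?I (Suc T)"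
    by (rule nn_integral_multc) (rule prod_meas)
  also have "\<dots> = (\<Prod>t=1..Suc T. ?I t)"
    unfolding Suc.IH by simp
  finally show ?case .
qed

lemma joint_density_pos:
  assumes "valid_lgssm T M"
  shows "0 < joint_density T M y s"
  unfolding joint_density_def
  using assms by (intro mult_pos_pos prod_pos) (auto simp: valid_lgssm_def mvn_density_pos)

text \<open>
  Each observation density is bounded, so the product of the transition densities dominates the
  joint density.
\<close>

lemma integrable_joint_density:
  fixes M :: "('d::finite, 'm::finite) lgssm"
  assumes valid: "valid_lgssm T M"
  shows "integrable (\<Pi>\<^sub>M t\<in>{1..T}. lborel) (joint_density T M y)"
proof -
  let ?P = "\<Pi>\<^sub>M t\<in>{1..T}. lborel :: (real^'d) measure"
  let ?B = "\<Prod>t\<in>obs_times M. 1 / mvn_normalizer (obs_cov M t)"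
  let ?g = "\<lambda>t s. mvn_density (predicted_state M s t) (trans_cov M t) (s t)"
  have obs: "t \<in> {1..T}" "pos_def_matrix (obs_cov M t)" if "t \<in> obs_times M" for t
    using valid that by (auto simp: valid_lgssm_def)
  have cov: "pos_def_matrix (trans_cov M t)" if "t \<in> {1..T}" for t
    using valid that by (auto simp: valid_lgssm_def)
  have comp [measurable]: "(\<lambda>s. s t) \<in> borel_measurable ?P" if "t \<in> {1..T}" for t
    using measurable_component_singleton[of t "{1..T}" "\<lambda>_. lborel"] that by simp
  have obs_meas: "(\<lambda>s. mvn_density (readout M t *v s t + obs_offset M t) (obs_cov M t) (y t))
      \<in> borel_measurable ?P" if "t \<in> obs_times M" for t
  proof -
    have "(\<lambda>s. readout M t *v s t + obs_offset M t) \<in> borel_measurable ?P"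
      by (rule measurable_compose[OF comp[OF obs(1)[OF that]] borel_measurable_continuous_onI])
        (intro continuous_intros)
    then show ?thesis
      by measurable
  qed
  have eq: "joint_density T M y s = (\<Prod>t=1..T. ?g t s) *
     (\<Prod>t\<in>obs_times M. mvn_density (readout M t *v s t + obs_offset M t) (obs_cov M t) (y t))" for s
    by (simp add: joint_density_def predicted_state_def)
  have "joint_density T M y \<in> borel_measurable ?P"
    unfolding eq[abs_def]
  proof (intro borel_measurable_times borel_measurable_prod obs_meas)
    fix t assume "t \<in> {1..T}"
    then show "?g t \<in> borel_measurable ?P"
      using measurable_predicted_state[of t T M] comp[of t] by measurable
  qed
  moreover have "(\<integral>\<^sup>+s. ennreal (norm (joint_density T M y s)) \<partial>?P) < \<infinity>"
  proof -
    have "norm (joint_density T M y s) = joint_density T M y s" for s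
      using joint_density_pos[OF valid, of y s] by simp
    moreover have "joint_density T M y s \<le> (\<Prod>t=1..T. ?g t s) * ?B" for s
      unfolding eq
      by (intro mult_left_mono prod_mono prod_nonneg conjI mvn_density_le
          less_imp_le[OF mvn_density_pos] obs(2) cov)
    ultimately have le: "ennreal (norm (joint_density T M y s)) \<le> ennreal ((\<Prod>t=1..T. ?g t s) * ?B)" for s
      by (simp only: ennreal_leI)
    have "ennreal ((\<Prod>t=1..T. ?g t s) * ?B) = (\<Prod>t=1..T. ennreal (?g t s)) * ennreal ?B" for s
    proof -
      have "(\<Prod>t=1..T. ennreal (?g t s)) = ennreal (\<Prod>t=1..T. ?g t s)"
        by (rule prod_ennreal) (rule less_imp_le[OF mvn_density_pos[OF cov]])
      moreover have "0 \<le> ?B"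
        by (intro prod_nonneg) (simp add: mvn_normalizer_pos[OF obs(2)] less_imp_le)
      ultimately show ?thesis
        by (simp only: ennreal_mult'')
    qed
    then have "(\<integral>\<^sup>+s. ennreal (norm (joint_density T M y s)) \<partial>?P)
      \<le> (\<integral>\<^sup>+s. (\<Prod>t=1..T. ennreal (?g t s)) * ennreal ?B \<partial>?P)"
      using le by (intro nn_integral_mono) simp
    also have "\<dots> = (\<integral>\<^sup>+s. (\<Prod>t=1..T. ennreal (?g t s)) \<partial>?P) * ennreal ?B"
    proof (rule nn_integral_multc, rule borel_measurable_prod_ennreal)
      fix t assume "t \<in> {1..T}"
      then show "(\<lambda>s. ennreal (?g t s)) \<in> borel_measurable ?P"
        using measurable_predicted_state[of t T M] comp[of t] by measurable
    qed
    also have "\<dots> = (\<Prod>t=1..T. \<integral>\<^sup>+x. ennreal (mvn_density 0 (trans_cov M t) x) \<partial>lborel) * ennreal ?B"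
      by (simp only: nn_integral_transition_densities)
    also have "\<dots> < \<infinity>"
    proof -
      have "(\<Prod>t=1..T. \<integral>\<^sup>+x. ennreal (mvn_density 0 (trans_cov M t) x) \<partial>lborel) \<noteq> top"
        using nn_integral_mvn_density_finite[OF cov] by (force simp: ennreal_prod_eq_top)
      then show ?thesis
        by (simp add: ennreal_mult_less_top less_top)
    qed
    finally show ?thesis .
  qed
  ultimately show ?thesis
    by (simp add: integrable_iff_bounded)
qed

lemma evidence_pos:
  fixes M :: "('d::finite, 'm::finite) lgssm"
  assumes valid: "valid_lgssm T M"
  shows "0 < (\<integral>s. joint_density T M y s \<partial>(\<Pi>\<^sub>M t\<in>{1..T}. lborel))"
proof -
  let ?P = "\<Pi>\<^sub>M t\<in>{1..T}. lborel :: (real^'d) measure"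
  interpret product_sigma_finite "\<lambda>_. lborel :: (real^'d) measure" ..
  note pos = joint_density_pos[OF valid]
  have "emeasure ?P (space ?P) = (\<Prod>t\<in>{1..T}. emeasure lborel (UNIV :: (real^'d) set))"
    using emeasure_PiM[of "{1..T}" "\<lambda>_. UNIV"] by (simp add: space_PiM)
  also have "\<dots> \<noteq> 0"
    by simp
  finally have "ae_filter ?P \<noteq> bot"
    by (simp add: ae_filter_eq_bot_iff)
  then have "\<not> (AE s in ?P. joint_density T M y s = 0)"
    using pos by (simp add: less_imp_neq[symmetric] trivial_limit_def[symmetric] order_less_imp_not_eq2)
  then have "(\<integral>s. joint_density T M y s \<partial>?P) \<noteq> 0"
    using integral_nonneg_eq_0_iff_AE[OF integrable_joint_density[OF valid]] pos less_imp_le by blast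
  moreover have "0 \<le> (\<integral>s. joint_density T M y s \<partial>?P)"
    by (rule integral_nonneg_AE) (simp add: pos less_imp_le)
  ultimately show ?thesis
    by simp
qed

text \<open>The negative logarithm of the joint density, up to an additive constant.\<close>

definition map_cost :: "nat \<Rightarrow> ('d::finite, 'm::finite) lgssm \<Rightarrow> (nat \<Rightarrow> real^'m) \<Rightarrow> (nat \<Rightarrow> real^'d) \<Rightarrow> real" where
  "map_cost T M y s =
    (\<Sum>t=1..T. (s t - predicted_state M s t) \<bullet> (matrix_inv (trans_cov M t) *v (s t - predicted_state M s t)) / 2) +
    (\<Sum>t\<in>obs_times M. (y t - (readout M t *v s t + obs_offset M t)) \<bullet>
      (matrix_inv (obs_cov M t) *v (y t - (readout M t *v s t + obs_offset M t))) / 2)"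

lemma joint_density_exp_map_cost:
  assumes "finite (obs_times M)"
  shows "joint_density T M y s = exp (- map_cost T M y s) /
     ((\<Prod>t=1..T. mvn_normalizer (trans_cov M t)) * (\<Prod>t\<in>obs_times M. mvn_normalizer (obs_cov M t)))"
  unfolding joint_density_def mvn_density_def mvn_normalizer_def[symmetric]
    predicted_state_def[symmetric] map_cost_def
  using assms
  by (simp add: prod_dividef exp_sum[symmetric] sum_negf exp_add[symmetric])

text \<open>The evidence is finite and positive, so dividing by it preserves the order of densities.\<close>

lemma is_MAP_iff_is_arg_min:
  assumes valid: "valid_lgssm T M"
  shows "is_MAP T M y s \<longleftrightarrow> is_arg_min (map_cost T M y) (\<lambda>s. s \<in> traj T) s"
proof -
  define Z where "Z = (\<integral>s. joint_density T M y s \<partial>(\<Pi>\<^sub>M t\<in>{1..T}. lborel))"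
  define C where "C = (\<Prod>t=1..T. mvn_normalizer (trans_cov M t)) *
    (\<Prod>t\<in>obs_times M. mvn_normalizer (obs_cov M t))"
  have "0 < Z"
    unfolding Z_def by (rule evidence_pos[OF valid])
  moreover have "0 < C"
    unfolding C_def using valid
    by (intro mult_pos_pos prod_pos) (auto simp: valid_lgssm_def mvn_normalizer_pos)
  moreover have "finite (obs_times M)"
    using valid finite_subset by (auto simp: valid_lgssm_def)
  then have "posterior_density T M y s = exp (- map_cost T M y s) / C / Z" for s
    unfolding posterior_density_def Z_def[symmetric] C_def
    by (subst joint_density_exp_map_cost) auto
  ultimately have "posterior_density T M y s < posterior_density T M y s'
    \<longleftrightarrow> map_cost T M y s' < map_cost T M y s" for s s'
    by (auto simp: divide_less_cancel mult_less_0_iff)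
  then show ?thesis
    by (simp add: is_MAP_def is_arg_max_def is_arg_min_def)
qed

section \<open>The stages of a linear Gaussian model as quadratic costs\<close>

text \<open>
  The part that depends on \<open>x\<close> and \<open>z\<close> in half the squared innovation \<open>z - (A x + b)\<close>, weighted by
  \<open>P\<close>, plus half the squared misfit \<open>e - H z\<close>, weighted by \<open>R\<close>.
\<close>

definition stage_quad ::
  "real^'d^'d \<Rightarrow> real^'d^'d \<Rightarrow> real^'d \<Rightarrow> real^'d^'m \<Rightarrow> real^'m^'m \<Rightarrow> real^'m \<Rightarrow> ('d::finite) quad" where
  "stage_quad A P b H R e =
     \<lparr> qll = transpose A ** P ** A,
       qlr = mat 0 - transpose A ** P,
       qrr = P + transpose H ** R ** H,
       lin_l = 0 - transpose A *v (P *v b),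
       lin_r = P *v b + transpose H *v (R *v e) \<rparr>"

lemma qval_stage_quad:
  fixes H :: "real^'d^'m"
  assumes P: "transpose P = P" and R: "transpose R = R"
  shows "(z - (A *v x + b)) \<bullet> (P *v (z - (A *v x + b))) / 2 + (e - H *v z) \<bullet> (R *v (e - H *v z)) / 2
    = qval (stage_quad A P b H R e) x z + (b \<bullet> (P *v b) / 2 + e \<bullet> (R *v e) / 2)"
proof -
  have square: "(u - v) \<bullet> (S *v (u - v)) = u \<bullet> (S *v u) - 2 * (v \<bullet> (S *v u)) + v \<bullet> (S *v v)"
    if "transpose S = S" for S :: "real^'n^'n" and u v
    using inner_symmetric_matrix[OF that, of u v]
    by (simp add: matrix_vector_mult_diff_distrib inner_diff_left inner_diff_right)
  have sum: "(u + v) \<bullet> (P *v (u + v)) = u \<bullet> (P *v u) + 2 * (u \<bullet> (P *v v)) + v \<bullet> (P *v v)" for u v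
    using inner_symmetric_matrix[OF P, of u v]
    by (simp add: matrix_vector_right_distrib inner_add_left inner_add_right)
  have A: "x \<bullet> (f v* A) = (A *v x) \<bullet> f" "(f v* A) \<bullet> x = (A *v x) \<bullet> f" for f
    by (simp_all add: inner_commute[of x "f v* A"] dot_lmul_matrix inner_commute[of f])
  have H: "z \<bullet> (f v* H) = (H *v z) \<bullet> f" "(f v* H) \<bullet> z = (H *v z) \<bullet> f" for f
    by (simp_all add: inner_commute[of z "f v* H"] dot_lmul_matrix inner_commute[of f])
  let ?q = "stage_quad A P b H R e"
  have "x \<bullet> (qll ?q *v x) = (A *v x) \<bullet> (P *v (A *v x))"
    by (simp add: stage_quad_def matrix_vector_mul_assoc[symmetric] A)
  moreover have "x \<bullet> (qlr ?q *v z) = - ((A *v x) \<bullet> (P *v z))"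
    by (simp add: stage_quad_def matrix_vector_mul_assoc[symmetric] matrix_vector_mult_minus A)
  moreover have "z \<bullet> (qrr ?q *v z) = z \<bullet> (P *v z) + (H *v z) \<bullet> (R *v (H *v z))"
    by (simp add: stage_quad_def matrix_vector_mul_assoc[symmetric] matrix_vector_mult_add_rdistrib
        inner_add_right H)
  moreover have "lin_l ?q \<bullet> x = - ((A *v x) \<bullet> (P *v b))"
    by (simp add: stage_quad_def A)
  moreover have "lin_r ?q \<bullet> z = b \<bullet> (P *v z) + (H *v z) \<bullet> (R *v e)"
    using inner_symmetric_matrix[OF P, of z b]
    by (simp add: stage_quad_def inner_add_left H inner_commute[of "P *v b"])
  moreover have "(A *v x + b) \<bullet> (P *v z) = (A *v x) \<bullet> (P *v z) + b \<bullet> (P *v z)"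
    by (simp add: inner_add_left)
  ultimately show ?thesis
    unfolding qval_def square[OF P] square[OF R] sum by argo
qed

lemma convex_stage_quad:
  fixes H :: "real^'d^'m"
  assumes P: "pos_def_matrix P" and R: "transpose R = R" "\<And>u. 0 \<le> u \<bullet> (R *v u)"
  shows "convex_quad (stage_quad A P b H R e)"
proof -
  have Psym: "transpose P = P"
    by (rule pos_def_matrix_transpose[OF P])
  have "homogeneous (stage_quad A P b H R e) = stage_quad A P 0 H R 0"
    by (simp add: homogeneous_def stage_quad_def)
  then have "0 \<le> qval (homogeneous (stage_quad A P b H R e)) x z" for x z
    using qval_stage_quad[OF Psym R(1), of z A x 0 0 H] pos_def_matrix_nonneg[OF P, of "z - A *v x"]
      R(2)[of "- (H *v z)"] by simp
  moreover have "pos_def_matrix (P + transpose H ** R ** H)"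
  proof (rule pos_def_matrix_add[OF P])
    show "transpose (transpose H ** R ** H) = transpose H ** R ** H"
      by (simp add: matrix_transpose_mul R(1) matrix_mul_assoc)
    have "x \<bullet> (f v* H) = (H *v x) \<bullet> f" for x f
      by (simp add: inner_commute[of x "f v* H"] dot_lmul_matrix inner_commute[of f])
    then have "x \<bullet> ((transpose H ** R ** H) *v x) = (H *v x) \<bullet> (R *v (H *v x))" for x
      by (simp add: matrix_vector_mul_assoc[symmetric])
    then show "0 \<le> x \<bullet> ((transpose H ** R ** H) *v x)" for x
      using R(2) by simp
  qed
  ultimately show ?thesis
    unfolding convex_quad_def
    by (simp add: stage_quad_def matrix_transpose_mul Psym matrix_mul_assoc)
qed

text \<open>An unobserved state is one observed with precision zero.\<close>

definition obs_precision :: "('d::finite, 'm::finite) lgssm \<Rightarrow> nat \<Rightarrow> real^'m^'m" where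
  "obs_precision M t = (if t \<in> obs_times M then matrix_inv (obs_cov M t) else mat 0)"

definition model_quad :: "nat \<Rightarrow> ('d::finite, 'm::finite) lgssm \<times> (nat \<Rightarrow> real^'m) \<Rightarrow> 'd quad" where
  "model_quad t w = (case w of (M, y) \<Rightarrow>
     stage_quad (trans M t) (matrix_inv (trans_cov M t)) (trans_offset M t)
       (readout M t) (obs_precision M t) (y t - obs_offset M t))"

lemma obs_precision_psd:
  assumes "valid_lgssm T M"
  shows "transpose (obs_precision M t) = obs_precision M t" "0 \<le> u \<bullet> (obs_precision M t *v u)"
proof -
  have inv: "pos_def_matrix (matrix_inv (obs_cov M t))" if "t \<in> obs_times M"
    using assms that by (intro pos_def_matrix_inv) (auto simp: valid_lgssm_def)
  show "transpose (obs_precision M t) = obs_precision M t"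
    using pos_def_matrix_transpose[OF inv] by (auto simp: obs_precision_def transpose_mat simp del: mat_0)
  show "0 \<le> u \<bullet> (obs_precision M t *v u)"
    using pos_def_matrix_nonneg[OF inv] by (auto simp: obs_precision_def)
qed

lemma convex_model_quad:
  assumes "valid_lgssm T M" "t \<in> {1..T}"
  shows "convex_quad (model_quad t (M, y))"
  unfolding model_quad_def prod.case using assms
  by (intro convex_stage_quad pos_def_matrix_inv obs_precision_psd)
    (auto simp: valid_lgssm_def)

text \<open>The constant collects the terms of the stages that contain no state.\<close>

lemma map_cost_eq_path_cost:
  assumes valid: "valid_lgssm T M"
  obtains c where
    "\<And>s. map_cost T M y s = path_cost model_quad (M, y) 0 T (s(0 := init_state M)) + c"
proof -
  let ?P = "\<lambda>t. matrix_inv (trans_cov M t)" and ?R = "obs_precision M"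
  let ?b = "trans_offset M" and ?e = "\<lambda>t. y t - obs_offset M t"
  let ?c = "\<lambda>t. ?b t \<bullet> (?P t *v ?b t) / 2 + ?e t \<bullet> (?R t *v ?e t) / 2"
  have K: "obs_times M \<subseteq> {1..T}"
    using valid by (simp add: valid_lgssm_def)
  have Psym: "transpose (?P t) = ?P t" if "t \<in> {1..T}" for t
    using valid that
    by (intro pos_def_matrix_transpose pos_def_matrix_inv) (auto simp: valid_lgssm_def)
  note Rsym = obs_precision_psd(1)[OF valid]
  show thesis
  proof
    fix s :: "nat \<Rightarrow> real^'a"
    let ?s = "s(0 := init_state M)"
    have "(\<Sum>t\<in>obs_times M. (y t - (readout M t *v s t + obs_offset M t)) \<bullet>
        (matrix_inv (obs_cov M t) *v (y t - (readout M t *v s t + obs_offset M t))) / 2)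
      = (\<Sum>t\<in>obs_times M. (?e t - readout M t *v s t) \<bullet> (?R t *v (?e t - readout M t *v s t)) / 2)"
      by (rule sum.cong) (simp_all add: obs_precision_def algebra_simps)
    also have "\<dots> = (\<Sum>t=1..T. (?e t - readout M t *v s t) \<bullet> (?R t *v (?e t - readout M t *v s t)) / 2)"
      using K by (intro sum.mono_neutral_left) (auto simp: obs_precision_def)
    finally have "map_cost T M y s = (\<Sum>t=1..T.
      (s t - predicted_state M s t) \<bullet> (?P t *v (s t - predicted_state M s t)) / 2
      + (?e t - readout M t *v s t) \<bullet> (?R t *v (?e t - readout M t *v s t)) / 2)"
      by (simp add: map_cost_def sum.distrib)
    also have "\<dots> = (\<Sum>t=1..T. qval (model_quad t (M, y)) (?s (t - 1)) (?s t) + ?c t)"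
    proof (rule sum.cong[OF refl])
      fix t assume t: "t \<in> {1..T}"
      then have "?s t = s t"
        by auto
      then show "(s t - predicted_state M s t) \<bullet> (?P t *v (s t - predicted_state M s t)) / 2
          + (?e t - readout M t *v s t) \<bullet> (?R t *v (?e t - readout M t *v s t)) / 2
        = qval (model_quad t (M, y)) (?s (t - 1)) (?s t) + ?c t"
        using qval_stage_quad[OF Psym[OF t] Rsym[of t], of "s t" "trans M t" "?s (t - 1)" "?b t" "?e t"
            "readout M t"]
        by (simp only: predicted_state_def model_quad_def prod.case)
    qed
    also have "\<dots> = path_cost model_quad (M, y) 0 T ?s + (\<Sum>t=1..T. ?c t)"
      by (simp only: sum.distrib path_cost_def atLeastSucAtMost_greaterThanAtMost One_nat_def)
    finally show "map_cost T M y s = path_cost model_quad (M, y) 0 T ?s + (\<Sum>t=1..T. ?c t)" .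
  qed
qed

lemma is_MAP_iff_path:
  assumes valid: "valid_lgssm T M"
  shows "is_MAP T M y s \<longleftrightarrow> s \<in> traj T \<and> (\<forall>s'. s' 0 = init_state M \<longrightarrow>
    path_cost model_quad (M, y) 0 T (s(0 := init_state M)) \<le> path_cost model_quad (M, y) 0 T s')"
proof -
  let ?V = "path_cost model_quad (M, y) 0 T"
  obtain c where c: "\<And>s. map_cost T M y s = ?V (s(0 := init_state M)) + c"
    using map_cost_eq_path_cost[OF valid] by blast
  have "(\<forall>s'\<in>traj T. ?V v \<le> ?V (s'(0 := init_state M))) \<longleftrightarrow>
      (\<forall>s'. s' 0 = init_state M \<longrightarrow> ?V v \<le> ?V s')" for v
  proof (intro iffI ballI allI impI)
    fix s' :: "nat \<Rightarrow> real^'a"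
    assume min: "\<forall>s'\<in>traj T. ?V v \<le> ?V (s'(0 := init_state M))" and s': "s' 0 = init_state M"
    have "?V ((restrict s' {1..T})(0 := init_state M)) = ?V s'"
      unfolding path_cost_def using s' by (intro sum.cong) auto
    moreover have "restrict s' {1..T} \<in> traj T"
      by (simp add: traj_def)
    ultimately show "?V v \<le> ?V s'"
      using min by metis
  qed simp
  then show ?thesis
    unfolding is_MAP_iff_is_arg_min[OF valid] is_arg_min_linorder c by auto
qed

text \<open>Time to assemble one stage from the inputs; all stages are assembled at the same time.\<close>

definition stage_time :: "'d::finite itself \<Rightarrow> 'm::finite itself \<Rightarrow> nat" where
  "stage_time _ _ = 3 * CARD('d) + fact CARD('d) + 3 * CARD('m) + fact CARD('m) + 11"

lemma model_quad_computable:
  fixes W :: "(('d::finite, 'm::finite) lgssm \<times> (nat \<Rightarrow> real^'m)) set"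
  assumes W: "\<And>w. w \<in> W \<Longrightarrow> valid_lgssm T (fst w)" "\<And>w. w \<in> W \<Longrightarrow> obs_times (fst w) = K"
    and t: "t \<in> {1..T}"
  shows "instances.quad_computable (\<lambda>w. lgssm_data (fst w) (snd w)) W
    (stage_time TYPE('d) TYPE('m)) (model_quad t)"
proof -
  interpret instances "\<lambda>w :: ('d, 'm) lgssm \<times> (nat \<Rightarrow> real^'m). lgssm_data (fst w) (snd w)" W .
  let ?k = "CARD('d) + fact CARD('d) + CARD('m) + fact CARD('m) + 6"
  let ?k' = "?k + 2 * CARD('d) + 2 * CARD('m) + 4"
  let ?A = "\<lambda>w :: ('d, 'm) lgssm \<times> (nat \<Rightarrow> real^'m). trans (fst w) t"
    and ?P = "\<lambda>w :: ('d, 'm) lgssm \<times> (nat \<Rightarrow> real^'m). matrix_inv (trans_cov (fst w) t)"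
    and ?b = "\<lambda>w :: ('d, 'm) lgssm \<times> (nat \<Rightarrow> real^'m). trans_offset (fst w) t"
    and ?H = "\<lambda>w :: ('d, 'm) lgssm \<times> (nat \<Rightarrow> real^'m). readout (fst w) t"
    and ?R = "\<lambda>w :: ('d, 'm) lgssm \<times> (nat \<Rightarrow> real^'m). obs_precision (fst w) t"
    and ?e = "\<lambda>w :: ('d, 'm) lgssm \<times> (nat \<Rightarrow> real^'m). snd w t - obs_offset (fst w) t"
  have inputs: "mat_computable 0 ?A" "mat_computable 0 ?H" "vec_computable 0 ?b"
    "mat_computable 0 (\<lambda>w. trans_cov (fst w) t)" "mat_computable 0 (\<lambda>w. obs_cov (fst w) t)"
    "vec_computable 0 (\<lambda>w. snd w t)" "vec_computable 0 (\<lambda>w. obs_offset (fst w) t)"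
    unfolding mat_computable_def vec_computable_def
    using computable_input[of "In_trans t _ _"] computable_input[of "In_readout t _ _"]
      computable_input[of "In_trans_offset t _"] computable_input[of "In_trans_cov t _ _"]
      computable_input[of "In_obs_cov t _ _"] computable_input[of "In_obs t _"]
      computable_input[of "In_obs_offset t _"]
    by simp_all
  have A: "mat_computable ?k ?A" and H: "mat_computable ?k ?H" and b: "vec_computable ?k ?b"
    using inputs mat_computable_mono vec_computable_mono by blast+
  have e: "vec_computable ?k ?e"
    by (rule vec_computable_mono[OF vec_computable_diff[OF inputs(6,7)]]) simp
  have P: "mat_computable ?k ?P"
    by (rule mat_computable_mono[OF mat_computable_inverse[OF inputs(4)]])
      (use W t in \<open>auto simp: valid_lgssm_def intro!: pos_def_matrix_det_nz\<close>)
  have R: "mat_computable ?k ?R"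
  proof (cases "t \<in> K")
    case True
    have "mat_computable ?k (\<lambda>w. matrix_inv (obs_cov (fst w) t))"
      by (rule mat_computable_mono[OF mat_computable_inverse[OF inputs(5)]])
        (use W True in \<open>auto simp: valid_lgssm_def intro!: pos_def_matrix_det_nz\<close>)
    then show ?thesis
      by (rule mat_computable_cong) (simp add: obs_precision_def W(2) True)
  next
    case False
    have "mat_computable ?k (\<lambda>w. mat 0 :: real^'m^'m)"
      by (rule mat_computable_mono[OF mat_computable_zero]) simp
    then show ?thesis
      by (rule mat_computable_cong) (simp add: obs_precision_def W(2) False)
  qed
  have AP: "mat_computable (?k + CARD('d) + 2) (\<lambda>w. transpose (?A w) ** ?P w)"
    by (intro mat_mat_computable mat_computable_transpose A P)
  have HR: "mat_computable (?k + CARD('m) + 2) (\<lambda>w. transpose (?H w) ** ?R w)"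
    by (intro mat_mat_computable mat_computable_transpose H R)
  have Pb: "vec_computable (?k + CARD('d) + 2) (\<lambda>w. ?P w *v ?b w)"
    by (intro mat_vec_computable P b)
  have Re: "vec_computable (?k + CARD('m) + 2) (\<lambda>w. ?R w *v ?e w)"
    by (intro mat_vec_computable R e)
  have zero: "mat_computable ?k' (\<lambda>w. mat 0 :: real^'d^'d)" "vec_computable ?k' (\<lambda>w. 0 :: real^'d)"
    by (rule mat_computable_mono[OF mat_computable_zero]; simp)
      (rule vec_computable_mono[OF vec_computable_zero]; simp)
  have terms: "mat_computable (Suc ?k') (\<lambda>w. transpose (?A w) ** ?P w ** ?A w)"
    "mat_computable ?k' (\<lambda>w. transpose (?A w) ** ?P w)"
    "mat_computable ?k' ?P"
    "mat_computable ?k' (\<lambda>w. transpose (?H w) ** ?R w ** ?H w)"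
    "vec_computable ?k' (\<lambda>w. transpose (?A w) *v (?P w *v ?b w))"
    "vec_computable ?k' (\<lambda>w. ?P w *v ?b w)"
    "vec_computable ?k' (\<lambda>w. transpose (?H w) *v (?R w *v ?e w))"
  proof -
    show "mat_computable (Suc ?k') (\<lambda>w. transpose (?A w) ** ?P w ** ?A w)"
      by (rule mat_computable_mono[OF mat_mat_computable[OF AP mat_computable_mono[OF A]]]) auto
    show "mat_computable ?k' (\<lambda>w. transpose (?A w) ** ?P w)"
      by (rule mat_computable_mono[OF AP]) auto
    show "mat_computable ?k' ?P"
      by (rule mat_computable_mono[OF P]) auto
    show "mat_computable ?k' (\<lambda>w. transpose (?H w) ** ?R w ** ?H w)"
      by (rule mat_computable_mono[OF mat_mat_computable[OF HR mat_computable_mono[OF H]]]) auto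
    show "vec_computable ?k' (\<lambda>w. transpose (?A w) *v (?P w *v ?b w))"
      by (rule vec_computable_mono[OF mat_vec_computable[OF
              mat_computable_mono[OF mat_computable_transpose[OF A]] Pb]]) auto
    show "vec_computable ?k' (\<lambda>w. ?P w *v ?b w)"
      by (rule vec_computable_mono[OF Pb]) auto
    show "vec_computable ?k' (\<lambda>w. transpose (?H w) *v (?R w *v ?e w))"
      by (rule vec_computable_mono[OF mat_vec_computable[OF
              mat_computable_mono[OF mat_computable_transpose[OF H]] Re]]) auto
  qed
  have "quad_computable (Suc ?k') (\<lambda>w. stage_quad (?A w) (?P w) (?b w) (?H w) (?R w) (?e w))"
    unfolding quad_computable_def stage_quad_def quad.simps
    by (intro conjI mat_computable_diff mat_computable_add vec_computable_diff vec_computable_add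
        terms zero)
  then have "quad_computable (Suc ?k') (model_quad t)"
    by (simp add: model_quad_def[abs_def] case_prod_beta)
  then show ?thesis
    by (rule quad_computable_mono) (simp add: stage_time_def)
qed

lemma MAP_program:
  fixes K :: "nat set"
  assumes T: "1 \<le> T" "T \<le> 2 ^ n"
  obtains p out and prog :: "('d::finite, 'm::finite) lgssm_input program"
  where "runs_on p prog"
    "length prog = stage_time TYPE('d) TYPE('m) + (2 * n + 1) * join_time TYPE('d) + 1"
    "computes_MAP T K prog out"
proof -
  let ?W = "{w :: ('d, 'm) lgssm \<times> (nat \<Rightarrow> real^'m). valid_lgssm T (fst w) \<and> obs_times (fst w) = K}"
  interpret instances "\<lambda>w :: ('d, 'm) lgssm \<times> (nat \<Rightarrow> real^'m). lgssm_data (fst w) (snd w)" ?W .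
  let ?c = "stage_time TYPE('d) TYPE('m)"
  let ?d = "?c + (2 * n + 1) * join_time TYPE('d)"
  have quads: "quad_computable ?c (model_quad t)" if "t \<in> {1..T}" for t
    by (rule model_quad_computable[where K = K, OF _ _ that]) auto
  have convex: "convex_quad (model_quad t w)" if "t \<in> {1..T}" "w \<in> ?W" for t w
    by (rule convex_model_quad[of T "fst w" t "snd w", unfolded prod.collapse]) (use that in auto)
  have init: "vec_computable ?c (\<lambda>w. init_state (fst w))"
    by (rule vec_computable_mono[of 0])
      (use computable_input[of "In_init _"] in \<open>simp_all add: vec_computable_def\<close>)
  have "1 \<le> ?c"
    by (simp add: stage_time_def)
  obtain \<sigma> where \<sigma>: "\<And>t. t \<in> {1..T} \<Longrightarrow> vec_computable ?d (\<sigma> t)"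
    "\<And>w s. w \<in> ?W \<Longrightarrow> s 0 = init_state (fst w) \<Longrightarrow>
      (\<forall>s'. s' 0 = init_state (fst w) \<longrightarrow> path_cost model_quad w 0 T s \<le> path_cost model_quad w 0 T s') \<longleftrightarrow>
      (\<forall>t\<in>{1..T}. s t = \<sigma> t w)"
    by (rule path_minimizer_computable[OF quads convex init T \<open>1 \<le> ?c\<close>]) blast+
  have "\<forall>t i. \<exists>e. t \<in> {1..T} \<longrightarrow> depth e \<le> ?d \<and>
      (\<forall>w\<in>?W. denote (lgssm_data (fst w) (snd w)) e = Some (\<sigma> t w $ i))"
    using \<sigma>(1) unfolding vec_computable_def computable_def by blast
  then obtain e where "\<forall>t i. t \<in> {1..T} \<longrightarrow> depth (e t i) \<le> ?d \<and>
      (\<forall>w\<in>?W. denote (lgssm_data (fst w) (snd w)) (e t i) = Some (\<sigma> t w $ i))"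
    unfolding choice_iff by (elim exE)
  then have e: "\<And>t i. t \<in> {1..T} \<Longrightarrow> depth (e t i) \<le> ?d"
    "\<And>t i w. t \<in> {1..T} \<Longrightarrow> w \<in> ?W \<Longrightarrow>
      denote (lgssm_data (fst w) (snd w)) (e t i) = Some (\<sigma> t w $ i)"
    by blast+
  \<comment> \<open>An output has to be in a register, even if its expression is a bare input cell; adding zero
    puts it there at the cost of one step.\<close>
  define root where "root = (\<lambda>t i. Node Plus (e t i) (Lit 0))"
  let ?E = "(\<lambda>(t, i). root t i) ` ({1..T} \<times> (UNIV :: 'd set))"
  have E: "finite ?E"
    by simp
  have depth_E: "depth r \<le> ?d + 1" if r: "r \<in> ?E" for r
  proof -
    obtain t i where "t \<in> {1..T}" "r = root t i"
      using r by auto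
    then show ?thesis
      using e(1)[of t i] \<open>1 \<le> ?c\<close> by (simp add: root_def)
  qed
  obtain p prog reg where prog: "runs_on p prog" "length prog = ?d + 1"
    "\<And>r inp. r \<in> ?E \<Longrightarrow> 0 < depth r \<Longrightarrow> run prog inp (Reg (reg r)) = denote inp r"
    by (rule program_of_exprs[OF E depth_E], assumption) blast
  have out: "run prog (lgssm_data (fst w) (snd w)) (Reg (reg (root t i))) = Some (\<sigma> t w $ i)"
    if "t \<in> {1..T}" "w \<in> ?W" for t i w
  proof -
    have "root t i \<in> ?E"
      using that(1) by auto
    then have "run prog (lgssm_data (fst w) (snd w)) (Reg (reg (root t i)))
      = denote (lgssm_data (fst w) (snd w)) (root t i)"
      by (rule prog(3)) (simp add: root_def)
    then show ?thesis
      using e(2)[OF that] by (simp add: root_def)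
  qed
  have "computes_MAP T K prog (\<lambda>t i. reg (root t i))"
    unfolding computes_MAP_def
  proof (intro allI impI)
    fix M :: "('d, 'm) lgssm" and y :: "nat \<Rightarrow> real^'m"
    assume M: "valid_lgssm T M \<and> obs_times M = K"
    then have w: "(M, y) \<in> ?W"
      by simp
    let ?s = "restrict (\<lambda>t. \<sigma> t (M, y)) {1..T}"
    have "is_MAP T M y s \<longleftrightarrow> s = ?s" for s
    proof -
      have "is_MAP T M y s \<longleftrightarrow> s \<in> traj T \<and> (\<forall>t\<in>{1..T}. (s(0 := init_state M)) t = \<sigma> t (M, y))"
        using is_MAP_iff_path[of T M y s] \<sigma>(2)[OF w, of "s(0 := init_state M)"] M by simp
      also have "\<dots> \<longleftrightarrow> s = ?s"
        by (auto simp: traj_def PiE_def extensional_def fun_eq_iff)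
      finally show ?thesis .
    qed
    then have "Collect (is_MAP T M y) = {?s}"
      by auto
    moreover have "\<forall>t\<in>{1..T}. \<forall>i. run prog (lgssm_data M y) (Reg (reg (root t i))) = Some (?s t $ i)"
      using out[OF _ w] by simp
    ultimately show "\<exists>s. Collect (is_MAP T M y) = {s} \<and>
        (\<forall>t\<in>{1..T}. \<forall>i. run prog (lgssm_data M y) (Reg (reg (root t i))) = Some (s t $ i))"
      by blast
  qed
  with prog show thesis
    using that by auto
qed

section \<open>The Levenberg--Marquardt objective as a MAP cost\<close>

lemma jacobian_eqI:
  fixes g :: "real^'n \<Rightarrow> real^'k"
  assumes "(g has_derivative (\<lambda>h. A *v h)) (at x)"
  shows "jacobian g (at x) = A"
proof -
  have "frechet_derivative g (at x) = (\<lambda>h. A *v h)"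
    using frechet_derivative_at[OF assms] by simp
  then show ?thesis
    by (simp add: jacobian_def)
qed

text \<open>
  The Jacobian is block bidiagonal: identities on the diagonal, and below it the negated
  Jacobians of the transition functions.
\<close>

lemma residual_jac_mult:
  fixes f :: "nat \<Rightarrow> real^'d \<Rightarrow> real^'d"
  assumes f: "f t differentiable_on UNIV" and t: "1 \<le> t" and u: "1 \<le> u"
  shows "residual_jac f s0 s t u *v v =
    (if u = t then v else 0) + (if u = t - 1 then - (jacobian (f t) (at (s u)) *v v) else 0)"
proof -
  have "t - 1 \<noteq> t"
    using t by simp
  consider "u = t" | "u = t - 1" "u \<noteq> t" | "u \<noteq> t" "u \<noteq> t - 1"
    by blast
  then show ?thesis
  proof cases
    case 1
    have "(\<lambda>x. residual f s0 (s(u := x)) t) = (\<lambda>x. x - f t ((s(0 := s0)) (t - 1)))"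
      using 1 \<open>t - 1 \<noteq> t\<close> by (auto simp: residual_def fun_eq_iff)
    then have "residual_jac f s0 s t u = mat 1"
      unfolding residual_jac_def by (auto intro!: jacobian_eqI derivative_eq_intros)
    then show ?thesis
      using 1 \<open>t - 1 \<noteq> t\<close> by simp
  next
    case 2
    have "f t differentiable at (s u)"
      using f by (simp add: differentiable_on_def)
    then have "(f t has_derivative (\<lambda>h. jacobian (f t) (at (s u)) *v h)) (at (s u))"
      by (simp add: jacobian_works)
    then have "((\<lambda>x. s t - f t x) has_derivative (\<lambda>h. - jacobian (f t) (at (s u)) *v h)) (at (s u))"
      by (auto intro!: derivative_eq_intros simp: matrix_vector_mult_minus)
    moreover have "(\<lambda>x. residual f s0 (s(u := x)) t) = (\<lambda>x. s t - f t x)"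
      using 2 u by (auto simp: residual_def fun_eq_iff)
    ultimately have "residual_jac f s0 s t u = - jacobian (f t) (at (s u))"
      unfolding residual_jac_def by (simp add: jacobian_eqI)
    then show ?thesis
      using 2 by (simp add: matrix_vector_mult_minus)
  next
    case 3
    have "(\<lambda>x. residual f s0 (s(u := x)) t) = (\<lambda>x. residual f s0 s t)"
      using 3 by (auto simp: residual_def fun_eq_iff)
    then have "residual_jac f s0 s t u = mat 0"
      unfolding residual_jac_def by (auto intro!: jacobian_eqI)
    then show ?thesis
      using 3 by simp
  qed
qed

lemma matrix_inv_mat_mult:
  fixes v :: "real^'n"
  assumes "0 < c"
  shows "matrix_inv (mat c) *v v = v /\<^sub>R c"
proof -
  let ?S = "mat c :: real^'n^'n"
  have "?S *v (v /\<^sub>R c) = v"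
    using assms by (simp add: mat_mult_vec)
  then have "matrix_inv ?S *v v = matrix_inv ?S *v (?S *v (v /\<^sub>R c))"
    by simp
  also have "\<dots> = v /\<^sub>R c"
    unfolding matrix_vector_mul_assoc
      matrix_inv_inverse(2)[OF pos_def_matrix_det_nz[OF pos_def_matrix_mat[OF assms]]]
    by (rule matrix_vector_mul_lid)
  finally show ?thesis .
qed

lemma valid_lm_lgssm: "0 \<le> lam \<Longrightarrow> valid_lgssm T (lm_lgssm f s0 T lam s)"
  by (auto simp: valid_lgssm_def lm_lgssm_def Let_def intro!: pos_def_matrix_mat)

text \<open>
  The residual linearized at \<open>s\<close> in direction \<open>\<Delta>\<close> is the innovation of the trajectory \<open>s + \<Delta>\<close> in
  the linearized dynamics, and the penalty on \<open>\<Delta>\<close> is the misfit of \<open>s + \<Delta>\<close> to the data \<open>s\<close>.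
\<close>

lemma map_cost_lm_lgssm:
  fixes f :: "nat \<Rightarrow> real^'d \<Rightarrow> real^'d"
  assumes f: "\<forall>t\<in>{1..T}. f t differentiable_on UNIV" and lam: "0 \<le> lam"
  shows "map_cost T (lm_lgssm f s0 T lam s) s (traj_add T s \<Delta>) = lm_objective f s0 T lam s \<Delta>"
proof -
  let ?M = "lm_lgssm f s0 T lam s" and ?z = "traj_add T s \<Delta>"
  let ?x = "\<lambda>t. (s(0 := s0)) (t - 1)"
  have innovation: "?z t - predicted_state ?M ?z t
      = residual f s0 s t + (\<Sum>u=1..T. residual_jac f s0 s t u *v \<Delta> u)" if t: "t \<in> {1..T}" for t
  proof -
    let ?A = "jacobian (f t) (at (?x t))"
    have "(\<Sum>u=1..T. residual_jac f s0 s t u *v \<Delta> u)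
      = (\<Sum>u=1..T. (if u = t then \<Delta> u else 0) + (if u = t - 1 then - (?A *v \<Delta> u) else 0))"
      using f t by (intro sum.cong[OF refl]) (auto simp: residual_jac_mult)
    also have "\<dots> = \<Delta> t - (if t = 1 then 0 else ?A *v \<Delta> (t - 1))"
      using t by (auto simp: sum.distrib sum.delta)
    finally have J: "(\<Sum>u=1..T. residual_jac f s0 s t u *v \<Delta> u)
      = \<Delta> t - (if t = 1 then 0 else ?A *v \<Delta> (t - 1))" .
    have pred: "predicted_state ?M ?z t = ?A *v ((?z(0 := s0)) (t - 1)) + (f t (?x t) - ?A *v ?x t)"
      by (simp add: predicted_state_def lm_lgssm_def Let_def)
    show ?thesis
    proof (cases "t = 1")
      case True
      then show ?thesis
        unfolding J pred residual_def using t by (simp add: traj_add_def)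
    next
      case False
      then have "(?z(0 := s0)) (t - 1) = ?x t + \<Delta> (t - 1)"
        using t by (auto simp: traj_add_def)
      then show ?thesis
        unfolding J pred residual_def using t False
        by (simp add: traj_add_def matrix_vector_right_distrib)
    qed
  qed
  have process: "matrix_inv (trans_cov ?M t) *v v = v" for t v
    using matrix_inv_mat_mult[of 1 v] by (simp add: lm_lgssm_def Let_def)
  have "(\<Sum>t\<in>obs_times ?M. (s t - (readout ?M t *v ?z t + obs_offset ?M t)) \<bullet>
      (matrix_inv (obs_cov ?M t) *v (s t - (readout ?M t *v ?z t + obs_offset ?M t))) / 2)
    = lam / 2 * (\<Sum>t=1..T. (norm (\<Delta> t))\<^sup>2)"
  proof (cases "lam = 0")
    case False
    then have "0 < 1 / lam"
      using lam by simp
    then have "matrix_inv (mat (1 / lam)) *v v = lam *\<^sub>R v" for v :: "real^'d"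
      by (simp add: matrix_inv_mat_mult)
    then show ?thesis
      using False unfolding sum_distrib_left
      by (intro sum.cong) (auto simp: lm_lgssm_def Let_def traj_add_def power2_norm_eq_inner)
  qed (simp add: lm_lgssm_def Let_def)
  moreover have "(\<Sum>t=1..T. (?z t - predicted_state ?M ?z t) \<bullet>
      (matrix_inv (trans_cov ?M t) *v (?z t - predicted_state ?M ?z t)) / 2)
    = 1 / 2 * (\<Sum>t=1..T. (norm (residual f s0 s t + (\<Sum>u=1..T. residual_jac f s0 s t u *v \<Delta> u)))\<^sup>2)"
    unfolding sum_distrib_left process
  proof (rule sum.cong[OF refl])
    fix t assume t: "t \<in> {1..T}"
    show "(?z t - predicted_state ?M ?z t) \<bullet> (?z t - predicted_state ?M ?z t) / 2
      = 1 / 2 * (norm (residual f s0 s t + (\<Sum>u=1..T. residual_jac f s0 s t u *v \<Delta> u)))\<^sup>2"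
      unfolding innovation[OF t] by (simp add: power2_norm_eq_inner)
  qed
  ultimately show ?thesis
    unfolding map_cost_def lm_objective_def by simp
qed

lemma traj_add_bij: "bij_betw (traj_add T s) (traj T) (traj T)"
proof (rule bij_betw_byWitness[where f' = "\<lambda>z. restrict (\<lambda>t. z t - s t) {1..T}"])
qed (auto simp: traj_def traj_add_def PiE_def extensional_def fun_eq_iff)

lemma lm_step_iff_MAP:
  fixes f :: "nat \<Rightarrow> real^'d \<Rightarrow> real^'d"
  assumes f: "\<forall>t\<in>{1..T}. f t differentiable_on UNIV" and lam: "0 \<le> lam" and \<Delta>: "\<Delta> \<in> traj T"
  shows "is_arg_min (lm_objective f s0 T lam s) (\<lambda>\<Delta>. \<Delta> \<in> traj T) \<Delta> \<longleftrightarrow>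
    is_MAP T (lm_lgssm f s0 T lam s) s (traj_add T s \<Delta>)"
proof -
  let ?V = "map_cost T (lm_lgssm f s0 T lam s) s"
  have "(\<forall>z\<in>traj T. ?V (traj_add T s \<Delta>) \<le> ?V z)
    \<longleftrightarrow> (\<forall>\<Delta>'\<in>traj T. ?V (traj_add T s \<Delta>) \<le> ?V (traj_add T s \<Delta>'))"
    using bij_betw_imp_surj_on[OF traj_add_bij[of T s]] by (metis (no_types, lifting) image_iff)
  moreover have "traj_add T s \<Delta> \<in> traj T"
    using bij_betw_apply[OF traj_add_bij \<Delta>] .
  ultimately show ?thesis
    unfolding is_MAP_iff_is_arg_min[OF valid_lm_lgssm[OF lam]] is_arg_min_linorder
    using \<Delta> by (auto simp: map_cost_lm_lgssm[OF f lam])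
qed

section \<open>Logarithmic parallel time\<close>

text \<open>The height of a balanced binary tree over \<open>T\<close> stages.\<close>

definition levels :: "nat \<Rightarrow> nat" where
  "levels T = nat \<lceil>log 2 (real T)\<rceil>"

lemma le_two_power_levels:
  assumes "1 \<le> T"
  shows "T \<le> 2 ^ levels T"
proof -
  have "real T = 2 powr log 2 (real T)"
    using assms by simp
  also have "\<dots> \<le> 2 powr real (levels T)"
    unfolding levels_def by (intro powr_mono real_nat_ceiling_ge) simp
  finally have "real T \<le> real (2 ^ levels T)"
    by (simp add: powr_realpow)
  then show ?thesis
    by (simp only: of_nat_le_iff)
qed

lemma affine_levels_bigo: "(\<lambda>T. real (a + b * levels T)) \<in> O(\<lambda>T. ln (real T))"
proof (rule bigoI)
  show "\<forall>\<^sub>F T in sequentially. norm (real (a + b * levels T))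
      \<le> (real a + real b * (1 / ln 2 + 1)) * norm (ln (real T))"
    \<comment> \<open>From 3 on the logarithm is at least 1 and absorbs the additive constant.\<close>
    using eventually_ge_at_top[of 3]
  proof eventually_elim
    fix T :: nat assume T: "3 \<le> T"
    have "exp 1 \<le> real T"
      using exp_le of_nat_mono[OF T, where 'a = real] by simp
    then have ln: "1 \<le> ln (real T)"
      using T by (simp add: ln_ge_iff)
    have "0 \<le> log 2 (real T)"
      using T by simp
    then have "real (levels T) \<le> log 2 (real T) + 1"
      unfolding levels_def by linarith
    also have "\<dots> = ln (real T) / ln 2 + 1"
      by (simp add: log_def)
    also have "\<dots> \<le> (1 / ln 2 + 1) * ln (real T)"
      using ln by (simp add: algebra_simps)
    finally have "real b * real (levels T) \<le> real b * ((1 / ln 2 + 1) * ln (real T))"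
      by (rule mult_left_mono) simp
    moreover have "real a \<le> real a * ln (real T)"
      using ln by (simp add: mult_left_mono[of 1 "ln (real T)" "real a", simplified])
    ultimately show "norm (real (a + b * levels T))
        \<le> (real a + real b * (1 / ln 2 + 1)) * norm (ln (real T))"
      using ln by (simp add: algebra_simps)
  qed
qed

theorem proposition4p1:
  shows
   "(\<forall>T (f :: nat \<Rightarrow> real^'d \<Rightarrow> real^'d) s0 s lam.
       T \<ge> 1 \<and> (\<forall>t\<in>{1..T}. f t differentiable_on UNIV) \<and> s \<in> traj T \<and> lam \<ge> 0 \<longrightarrow>
         valid_lgssm T (lm_lgssm f s0 T lam s) \<and>
         (\<forall>\<Delta>\<in>traj T.
            is_arg_min (lm_objective f s0 T lam s) (\<lambda>\<Delta>. \<Delta> \<in> traj T) \<Delta> \<longleftrightarrow>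
            is_MAP T (lm_lgssm f s0 T lam s) s (traj_add T s \<Delta>))) \<and>
    (\<exists>\<tau> :: nat \<Rightarrow> nat.
       (\<lambda>T. real (\<tau> T)) \<in> O(\<lambda>T. ln (real T)) \<and>
       (\<forall>T\<ge>1. \<forall>K\<subseteq>{1..T}. \<exists>p (prog :: ('d, 'm::finite) lgssm_input program) out.
          runs_on p prog \<and> length prog \<le> \<tau> T \<and> computes_MAP T K prog out))"
proof (intro conjI)
  show "\<forall>T (f :: nat \<Rightarrow> real^'d \<Rightarrow> real^'d) s0 s lam.
       T \<ge> 1 \<and> (\<forall>t\<in>{1..T}. f t differentiable_on UNIV) \<and> s \<in> traj T \<and> lam \<ge> 0 \<longrightarrow>
         valid_lgssm T (lm_lgssm f s0 T lam s) \<and>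
         (\<forall>\<Delta>\<in>traj T.
            is_arg_min (lm_objective f s0 T lam s) (\<lambda>\<Delta>. \<Delta> \<in> traj T) \<Delta> \<longleftrightarrow>
            is_MAP T (lm_lgssm f s0 T lam s) s (traj_add T s \<Delta>))"
    by (intro allI impI conjI ballI valid_lm_lgssm lm_step_iff_MAP) auto
next
  let ?j = "join_time TYPE('d)"
  let ?a = "stage_time TYPE('d) TYPE('m) + ?j + 1"
  let ?\<tau> = "\<lambda>T. ?a + 2 * ?j * levels T"
  have "\<exists>p (prog :: ('d, 'm) lgssm_input program) out.
      runs_on p prog \<and> length prog \<le> ?\<tau> T \<and> computes_MAP T K prog out" if "1 \<le> T" for T K
  proof -
    have "stage_time TYPE('d) TYPE('m) + (2 * levels T + 1) * ?j + 1 = ?\<tau> T"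
      by (simp add: algebra_simps)
    then show ?thesis
      using MAP_program[OF that le_two_power_levels[OF that], where ?'d = 'd and ?'m = 'm and K = K]
      by (metis order_refl)
  qed
  then show "\<exists>\<tau> :: nat \<Rightarrow> nat.
       (\<lambda>T. real (\<tau> T)) \<in> O(\<lambda>T. ln (real T)) \<and>
       (\<forall>T\<ge>1. \<forall>K\<subseteq>{1..T}. \<exists>p (prog :: ('d, 'm) lgssm_input program) out.
          runs_on p prog \<and> length prog \<le> \<tau> T \<and> computes_MAP T K prog out)"
    by (intro exI[of _ ?\<tau>] conjI affine_levels_bigo allI impI) blast
qed

end
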